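(* Let $\Bbbk$ be a field and let $\mathbf{S}$ be the category of sequences of $\Bbbk$-vector spaces. An object $V^\bullet$ of $\mathbf{S}$ is indecomposable if and only if $V^\bullet\cong S^\bullet_{a,b}$ for some $a\in\mathbb{Z}\cup\{-\infty\}$ and $b\in\mathbb{Z}\cup\{\infty\}$ with $a\le b$. An object $V^\bullet$ of $\mathbf{S}$ is completely decomposable if and only if $V^\bullet\in\mathbf{S}^d$.
   Context: An object $V^\bullet$ of $\mathbf{S}$ consists of $\Bbbk$-vector spaces $V^i$ and $\Bbbk$-linear maps $\mathrm{d}^i_V\colon V^i\to V^{i+1}$ for $i\in\mathbb{Z}$ (no condition on $\mathrm{d}^{i+1}_V\circ\mathrm{d}^i_V$); morphisms are families of linear maps commuting with the $\mathrm{d}^i$. A non-zero object is indecomposable if it is not a coproduct of two non-zero objects; an object is completely decomposable if it is a (possibly infinite) coproduct of indecomposable objects. For $a\in\mathbb{Z}\cup\{-\infty\}$, $b\in\mathbb{Z}\cup\{\infty\}$ with $a\le b$, $S^\bullet_{a,b}\in\mathbf{S}$ is defined by $S^i_{a,b}=\Bbbk$ for integers $a\le i\le b$ and $0$ otherwise, with $\mathrm{d}^i=(-1)^i\mathrm{id}_\Bbbk$ for $a\le i<b$ (and $0$ otherwise). $\mathbf{S}^d$ is the strictly full subcategory of $\mathbf{S}$ whose objects are the (possibly infinite) coproducts of objects of the form $S^\bullet_{a,b}$. *)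

theory Defs
  imports "HOL-Algebra.Module" "HOL-Algebra.Product_Groups" "HOL-Library.Extended"
begin

text \<open>
  Vector spaces over a field \<open>K\<close> are modules over \<open>K\<close> in the sense of HOL-Algebra. The ring
  multiplication and unit that the record type of modules inherits from rings carry no meaning,
  and maps only matter on carriers.
\<close>

definition linear_maps ::
  "('k, 'm) ring_scheme \<Rightarrow> ('k, 'v) module \<Rightarrow> ('k, 'w) module \<Rightarrow> ('v \<Rightarrow> 'w) set" where
  "linear_maps K M N =
     {f \<in> hom (add_monoid M) (add_monoid N).
        \<forall>a\<in>carrier K. \<forall>x\<in>carrier M. f (a \<odot>\<^bsub>M\<^esub> x) = a \<odot>\<^bsub>N\<^esub> f x}"

record ('k, 'v) seq =
  seq_space :: "int \<Rightarrow> ('k, 'v) module"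
  seq_diff :: "int \<Rightarrow> 'v \<Rightarrow> 'v"

definition seq_object :: "('k, 'm) ring_scheme \<Rightarrow> ('k, 'v) seq \<Rightarrow> bool" where
  "seq_object K V \<longleftrightarrow>
     (\<forall>i. module K (seq_space V i)) \<and>
     (\<forall>i. seq_diff V i \<in> linear_maps K (seq_space V i) (seq_space V (i + 1)))"

definition seq_morphisms ::
  "('k, 'm) ring_scheme \<Rightarrow> ('k, 'v) seq \<Rightarrow> ('k, 'w) seq \<Rightarrow> (int \<Rightarrow> 'v \<Rightarrow> 'w) set" where
  "seq_morphisms K V W =
     {f. (\<forall>i. f i \<in> linear_maps K (seq_space V i) (seq_space W i)) \<and>
         (\<forall>i. \<forall>x\<in>carrier (seq_space V i). f (i + 1) (seq_diff V i x) = seq_diff W i (f i x))}"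

definition seq_iso :: "('k, 'm) ring_scheme \<Rightarrow> ('k, 'v) seq \<Rightarrow> ('k, 'w) seq \<Rightarrow> bool" where
  "seq_iso K V W \<longleftrightarrow>
     (\<exists>f\<in>seq_morphisms K V W. \<exists>g\<in>seq_morphisms K W V.
        (\<forall>i. \<forall>x\<in>carrier (seq_space V i). g i (f i x) = x) \<and>
        (\<forall>i. \<forall>y\<in>carrier (seq_space W i). f i (g i y) = y))"

definition seq_zero :: "('k, 'v) seq \<Rightarrow> bool" where
  "seq_zero V \<longleftrightarrow> (\<forall>i. carrier (seq_space V i) = {\<zero>\<^bsub>seq_space V i\<^esub>})"

text \<open>
  The coproduct of a family is the degreewise direct sum, that is, the space of finitely
  supported families; \<open>seq_coproduct_universal\<close> below is its universal property.
\<close>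

definition direct_sum :: "'j set \<Rightarrow> ('j \<Rightarrow> ('k, 'v) module) \<Rightarrow> ('k, 'j \<Rightarrow> 'v) module" where
  "direct_sum J M =
     \<lparr>carrier = carrier (sum_group J (\<lambda>j. add_monoid (M j))),
      monoid.mult = (\<lambda>x y. undefined),
      one = undefined,
      zero = \<one>\<^bsub>sum_group J (\<lambda>j. add_monoid (M j))\<^esub>,
      add = monoid.mult (sum_group J (\<lambda>j. add_monoid (M j))),
      smult = (\<lambda>a x. \<lambda>j\<in>J. a \<odot>\<^bsub>M j\<^esub> x j)\<rparr>"

definition seq_coproduct :: "'j set \<Rightarrow> ('j \<Rightarrow> ('k, 'v) seq) \<Rightarrow> ('k, 'j \<Rightarrow> 'v) seq" where
  "seq_coproduct J W =
     \<lparr>seq_space = (\<lambda>i. direct_sum J (\<lambda>j. seq_space (W j) i)),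
      seq_diff = (\<lambda>i x. \<lambda>j\<in>J. seq_diff (W j) i (x j))\<rparr>"

definition seq_inclusion ::
  "'j set \<Rightarrow> ('j \<Rightarrow> ('k, 'v) seq) \<Rightarrow> 'j \<Rightarrow> int \<Rightarrow> 'v \<Rightarrow> 'j \<Rightarrow> 'v" where
  "seq_inclusion J W j i x = (\<lambda>l\<in>J. if l = j then x else \<zero>\<^bsub>seq_space (W l) i\<^esub>)"

text \<open>
  The summands are taken over the same type \<open>'v\<close> as \<open>V\<close>, and index sets below over \<open>int \<times> 'v\<close>.
  This is no restriction: summands of \<open>V\<close> embed into \<open>V\<close>, and choosing a non-zero homogeneous
  element in each non-zero summand embeds the index set into \<open>int \<times> 'v\<close>; see
  \<open>indecomposable_any_type\<close>, \<open>completely_decomposable_any_type\<close> and \<open>seq_Sd_any_type\<close>.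
\<close>

definition indecomposable :: "('k, 'm) ring_scheme \<Rightarrow> ('k, 'v) seq \<Rightarrow> bool" where
  "indecomposable K V \<longleftrightarrow>
     seq_object K V \<and> \<not> seq_zero V \<and>
     \<not> (\<exists>W1 W2 :: ('k, 'v) seq.
          seq_object K W1 \<and> seq_object K W2 \<and> \<not> seq_zero W1 \<and> \<not> seq_zero W2 \<and>
          seq_iso K V (seq_coproduct UNIV (\<lambda>b::bool. if b then W1 else W2)))"

definition completely_decomposable :: "('k, 'm) ring_scheme \<Rightarrow> ('k, 'v) seq \<Rightarrow> bool" where
  "completely_decomposable K V \<longleftrightarrow>
     seq_object K V \<and>
     (\<exists>(J :: (int \<times> 'v) set) (W :: int \<times> 'v \<Rightarrow> ('k, 'v) seq).
        (\<forall>j\<in>J. indecomposable K (W j)) \<and> seq_iso K V (seq_coproduct J W))"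

definition interval_ends :: "int extended \<Rightarrow> int extended \<Rightarrow> bool" where
  "interval_ends a b \<longleftrightarrow> a \<noteq> \<infinity> \<and> b \<noteq> -\<infinity> \<and> a \<le> b"

definition interval_seq ::
  "('k, 'm) ring_scheme \<Rightarrow> int extended \<Rightarrow> int extended \<Rightarrow> ('k, 'k) seq" where
  "interval_seq K a b =
     \<lparr>seq_space = (\<lambda>i.
        \<lparr>carrier = (if a \<le> Fin i \<and> Fin i \<le> b then carrier K else {\<zero>\<^bsub>K\<^esub>}),
         monoid.mult = (\<lambda>x y. undefined), one = undefined,
         zero = \<zero>\<^bsub>K\<^esub>, add = (\<oplus>\<^bsub>K\<^esub>), smult = (\<otimes>\<^bsub>K\<^esub>)\<rparr>),
      seq_diff = (\<lambda>i x.
        if a \<le> Fin i \<and> Fin i < b then (if even i then x else \<ominus>\<^bsub>K\<^esub> x) else \<zero>\<^bsub>K\<^esub>)\<rparr>"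

definition seq_Sd :: "('k, 'm) ring_scheme \<Rightarrow> ('k, 'v) seq set" where
  "seq_Sd K =
     {V. seq_object K V \<and>
         (\<exists>(J :: (int \<times> 'v) set) a b.
            (\<forall>j\<in>J. interval_ends (a j) (b j)) \<and>
            seq_iso K V (seq_coproduct J (\<lambda>j. interval_seq K (a j) (b j))))}"

subsection \<open>The coproduct\<close>

lemma linear_mapsI:
  assumes "\<And>x. x \<in> carrier M \<Longrightarrow> f x \<in> carrier N"
    and "\<And>x y. \<lbrakk>x \<in> carrier M; y \<in> carrier M\<rbrakk> \<Longrightarrow> f (x \<oplus>\<^bsub>M\<^esub> y) = f x \<oplus>\<^bsub>N\<^esub> f y"
    and "\<And>a x. \<lbrakk>a \<in> carrier K; x \<in> carrier M\<rbrakk> \<Longrightarrow> f (a \<odot>\<^bsub>M\<^esub> x) = a \<odot>\<^bsub>N\<^esub> f x"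
  shows "f \<in> linear_maps K M N"
  using assms by (auto simp: linear_maps_def hom_def)

lemma linear_mapsD:
  assumes "f \<in> linear_maps K M N"
  shows "x \<in> carrier M \<Longrightarrow> f x \<in> carrier N"
    and "\<lbrakk>x \<in> carrier M; y \<in> carrier M\<rbrakk> \<Longrightarrow> f (x \<oplus>\<^bsub>M\<^esub> y) = f x \<oplus>\<^bsub>N\<^esub> f y"
    and "\<lbrakk>a \<in> carrier K; x \<in> carrier M\<rbrakk> \<Longrightarrow> f (a \<odot>\<^bsub>M\<^esub> x) = a \<odot>\<^bsub>N\<^esub> f x"
  using assms by (auto simp: linear_maps_def hom_def)

lemma module_zero_smult:
  assumes "module K M" "x \<in> carrier M" shows "\<zero>\<^bsub>K\<^esub> \<odot>\<^bsub>M\<^esub> x = \<zero>\<^bsub>M\<^esub>"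
  using assms by (rule module.smult_l_null)

lemma module_zero_closed: "module K M \<Longrightarrow> \<zero>\<^bsub>M\<^esub> \<in> carrier M"
  by (simp add: module_def abelian_group_def abelian_monoid.zero_closed)

lemma linear_maps_zero:
  assumes "module K M" "module K N" "f \<in> linear_maps K M N"
  shows "f \<zero>\<^bsub>M\<^esub> = \<zero>\<^bsub>N\<^esub>"
proof -
  interpret K: cring K using assms(1) by (simp add: module_def)
  have "f \<zero>\<^bsub>M\<^esub> = f (\<zero>\<^bsub>K\<^esub> \<odot>\<^bsub>M\<^esub> \<zero>\<^bsub>M\<^esub>)"
    using assms by (simp add: module_zero_smult module_zero_closed)
  also have "\<dots> = \<zero>\<^bsub>K\<^esub> \<odot>\<^bsub>N\<^esub> f \<zero>\<^bsub>M\<^esub>"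
    using assms by (simp add: linear_mapsD module_zero_closed)
  finally show ?thesis
    using assms by (simp add: linear_mapsD module_zero_closed module_zero_smult)
qed

lemma linear_maps_comp:
  assumes "f \<in> linear_maps K M N" "g \<in> linear_maps K N P"
  shows "(\<lambda>x. g (f x)) \<in> linear_maps K M P"
  using assms by (intro linear_mapsI) (auto simp: linear_mapsD)

lemma group_add_monoid: "module K M \<Longrightarrow> group (add_monoid M)"
  by (simp add: module_def abelian_group.a_group)

lemma carrier_direct_sum:
  assumes "\<And>j. j \<in> J \<Longrightarrow> module K (M j)"
  shows "carrier (direct_sum J M) =
    {x \<in> \<Pi>\<^sub>E j\<in>J. carrier (M j). finite {j \<in> J. x j \<noteq> \<zero>\<^bsub>M j\<^esub>}}"
  using group_add_monoid[OF assms] by (simp add: direct_sum_def carrier_sum_group)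

lemma direct_sum_ops [simp]:
  "\<zero>\<^bsub>direct_sum J M\<^esub> = (\<lambda>j\<in>J. \<zero>\<^bsub>M j\<^esub>)"
  "x \<oplus>\<^bsub>direct_sum J M\<^esub> y = (\<lambda>j\<in>J. x j \<oplus>\<^bsub>M j\<^esub> y j)"
  "a \<odot>\<^bsub>direct_sum J M\<^esub> x = (\<lambda>j\<in>J. a \<odot>\<^bsub>M j\<^esub> x j)"
  by (simp_all add: direct_sum_def)

lemma module_direct_sum:
  assumes "cring K" and M: "\<And>j. j \<in> J \<Longrightarrow> module K (M j)"
  shows "module K (direct_sum J M)"
proof -
  note C = carrier_direct_sum[OF M]
  have am: "j \<in> J \<Longrightarrow> abelian_monoid (M j)" for j
    using M by (simp add: module_def abelian_group_def)
  have grp: "group (sum_group J (\<lambda>j. add_monoid (M j)))"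
    using group_add_monoid[OF M] by simp
  note grp' = group.is_monoid[OF grp]
  have ab: "abelian_group (direct_sum J M)"
  proof (rule abelian_groupI)
    fix x y assume x: "x \<in> carrier (direct_sum J M)" and y: "y \<in> carrier (direct_sum J M)"
    show "x \<oplus>\<^bsub>direct_sum J M\<^esub> y \<in> carrier (direct_sum J M)"
      using monoid.m_closed[OF grp', of x y] x y by (simp add: direct_sum_def)
    show "x \<oplus>\<^bsub>direct_sum J M\<^esub> y = y \<oplus>\<^bsub>direct_sum J M\<^esub> x"
      using x y by (auto simp: C PiE_iff intro!: restrict_ext abelian_monoid.a_comm am)
    fix z assume "z \<in> carrier (direct_sum J M)"
    then show "x \<oplus>\<^bsub>direct_sum J M\<^esub> y \<oplus>\<^bsub>direct_sum J M\<^esub> z =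
        x \<oplus>\<^bsub>direct_sum J M\<^esub> (y \<oplus>\<^bsub>direct_sum J M\<^esub> z)"
      using x y by (auto simp: C PiE_iff intro!: restrict_ext abelian_monoid.a_assoc am)
  next
    show "\<zero>\<^bsub>direct_sum J M\<^esub> \<in> carrier (direct_sum J M)"
      using monoid.one_closed[OF grp'] by (simp add: direct_sum_def)
    fix x assume x: "x \<in> carrier (direct_sum J M)"
    show "\<zero>\<^bsub>direct_sum J M\<^esub> \<oplus>\<^bsub>direct_sum J M\<^esub> x = x"
      using monoid.l_one[OF grp', of x] x by (simp add: direct_sum_def)
    show "\<exists>y\<in>carrier (direct_sum J M). y \<oplus>\<^bsub>direct_sum J M\<^esub> x = \<zero>\<^bsub>direct_sum J M\<^esub>"
      using group.l_inv_ex[OF grp, of x] x by (simp add: direct_sum_def)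
  qed
  show ?thesis
  proof (rule moduleI[OF \<open>cring K\<close> ab], goal_cases)
    case (1 a x)
    then have sub: "{j \<in> J. (\<lambda>j\<in>J. a \<odot>\<^bsub>M j\<^esub> x j) j \<noteq> \<zero>\<^bsub>M j\<^esub>} \<subseteq> {j \<in> J. x j \<noteq> \<zero>\<^bsub>M j\<^esub>}"
      using module.smult_r_null[OF M] by (auto simp: carrier_direct_sum[OF M])
    from 1 show ?case
      using M finite_subset[OF sub]
      by (auto simp: carrier_direct_sum[OF M] PiE_iff intro: module.smult_closed)
  next
    case (2 a b x) then show ?case
      using M by (auto simp: carrier_direct_sum[OF M] PiE_iff intro!: restrict_ext module.smult_l_distr)
  next
    case (3 a x y) then show ?case
      using M by (auto simp: carrier_direct_sum[OF M] PiE_iff intro!: restrict_ext module.smult_r_distr)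
  next
    case (4 a b x) then show ?case
      using M by (auto simp: carrier_direct_sum[OF M] PiE_iff intro!: restrict_ext module.smult_assoc1)
  next
    case (5 x) then show ?case
      using M by (auto simp: carrier_direct_sum[OF M] PiE_iff extensional_def fun_eq_iff intro: module.smult_one)
  qed
qed

lemma seq_objectD:
  assumes "seq_object K V"
  shows "module K (seq_space V i)"
    and "seq_diff V i \<in> linear_maps K (seq_space V i) (seq_space V (i + 1))"
  using assms by (auto simp: seq_object_def)

lemma linear_maps_direct_sum:
  assumes M: "\<And>j. j \<in> J \<Longrightarrow> module K (M j)" and N: "\<And>j. j \<in> J \<Longrightarrow> module K (N j)"
    and f: "\<And>j. j \<in> J \<Longrightarrow> f j \<in> linear_maps K (M j) (N j)"
  shows "(\<lambda>x. \<lambda>j\<in>J. f j (x j)) \<in> linear_maps K (direct_sum J M) (direct_sum J N)"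
proof (rule linear_mapsI)
  fix x assume x: "x \<in> carrier (direct_sum J M)"
  have sub: "{j \<in> J. (\<lambda>j\<in>J. f j (x j)) j \<noteq> \<zero>\<^bsub>N j\<^esub>} \<subseteq> {j \<in> J. x j \<noteq> \<zero>\<^bsub>M j\<^esub>}"
    using linear_maps_zero[OF M N f] by auto
  show "(\<lambda>j\<in>J. f j (x j)) \<in> carrier (direct_sum J N)"
    using x finite_subset[OF sub] linear_mapsD(1)[OF f]
    by (auto simp: carrier_direct_sum[OF M] carrier_direct_sum[OF N] PiE_iff)
qed (use linear_mapsD(2,3)[OF f] in
      \<open>auto simp: carrier_direct_sum[OF M] PiE_iff intro!: restrict_ext\<close>)

lemma seq_object_coproduct:
  assumes "cring K" and W: "\<And>j. j \<in> J \<Longrightarrow> seq_object K (W j)"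
  shows "seq_object K (seq_coproduct J W)"
  unfolding seq_object_def seq_coproduct_def
  by (auto intro!: module_direct_sum linear_maps_direct_sum assms seq_objectD[OF W])

lemma seq_inclusion_morphism:
  assumes "cring K" and W: "\<And>j. j \<in> J \<Longrightarrow> seq_object K (W j)" and j: "j \<in> J"
  shows "seq_inclusion J W j \<in> seq_morphisms K (W j) (seq_coproduct J W)"
proof -
  have M: "module K (seq_space (W j) i)" if "j \<in> J" for i j
    using seq_objectD(1)[OF W[OF that]] .
  have z: "l \<in> J \<Longrightarrow> seq_diff (W l) i \<zero>\<^bsub>seq_space (W l) i\<^esub> = \<zero>\<^bsub>seq_space (W l) (i + 1)\<^esub>" for l i
    using linear_maps_zero M seq_objectD(2)[OF W] by metis
  have "seq_inclusion J W j i \<in>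
      linear_maps K (seq_space (W j) i) (direct_sum J (\<lambda>j. seq_space (W j) i))" for i
  proof (rule linear_mapsI)
    fix x assume x: "x \<in> carrier (seq_space (W j) i)"
    have sub: "{l \<in> J. seq_inclusion J W j i x l \<noteq> \<zero>\<^bsub>seq_space (W l) i\<^esub>} \<subseteq> {j}"
      by (auto simp: seq_inclusion_def)
    show "seq_inclusion J W j i x \<in> carrier (direct_sum J (\<lambda>j. seq_space (W j) i))"
      using x finite_subset[OF sub] module_zero_closed[OF M]
      by (auto simp: carrier_direct_sum[OF M] seq_inclusion_def)
  next
    fix x y assume "x \<in> carrier (seq_space (W j) i)" "y \<in> carrier (seq_space (W j) i)"
    then show "seq_inclusion J W j i (x \<oplus>\<^bsub>seq_space (W j) i\<^esub> y) =
        seq_inclusion J W j i x \<oplus>\<^bsub>direct_sum J (\<lambda>j. seq_space (W j) i)\<^esub> seq_inclusion J W j i y"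
      using M by (auto simp: seq_inclusion_def module_def abelian_group_def
        abelian_monoid.l_zero abelian_monoid.zero_closed intro!: restrict_ext)
  next
    fix a x assume "a \<in> carrier K" "x \<in> carrier (seq_space (W j) i)"
    then show "seq_inclusion J W j i (a \<odot>\<^bsub>seq_space (W j) i\<^esub> x) =
        a \<odot>\<^bsub>direct_sum J (\<lambda>j. seq_space (W j) i)\<^esub> seq_inclusion J W j i x"
      using module.smult_r_null[OF M] by (auto simp: seq_inclusion_def intro!: restrict_ext)
  qed
  then show ?thesis
    using z by (auto simp: seq_morphisms_def seq_coproduct_def seq_inclusion_def fun_eq_iff)
qed

text \<open>Every finitely supported family is a finite sum of elements from the summands.\<close>

lemma direct_sum_induct:
  assumes M: "\<And>j. j \<in> J \<Longrightarrow> module K (M j)" and x: "x \<in> carrier (direct_sum J M)"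
    and zero: "P \<zero>\<^bsub>direct_sum J M\<^esub>"
    and add: "\<And>j u y. \<lbrakk>j \<in> J; u \<in> carrier (M j); y \<in> carrier (direct_sum J M);
       (\<lambda>l\<in>J. if l = j then u else \<zero>\<^bsub>M l\<^esub>) \<in> carrier (direct_sum J M); P y\<rbrakk> \<Longrightarrow>
       P ((\<lambda>l\<in>J. if l = j then u else \<zero>\<^bsub>M l\<^esub>) \<oplus>\<^bsub>direct_sum J M\<^esub> y)"
  shows "P x"
proof -
  have C: "carrier (direct_sum J M) =
      {x \<in> \<Pi>\<^sub>E j\<in>J. carrier (M j). finite {j \<in> J. x j \<noteq> \<zero>\<^bsub>M j\<^esub>}}"
    by (rule carrier_direct_sum) (rule M)
  have "finite F \<Longrightarrow> (\<And>x. x \<in> carrier (direct_sum J M) \<Longrightarrow> {j \<in> J. x j \<noteq> \<zero>\<^bsub>M j\<^esub>} = F \<Longrightarrow> P x)" for F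
  proof (induction F rule: finite_induct)
    case empty
    then have "x = \<zero>\<^bsub>direct_sum J M\<^esub>"
      by (auto simp: C PiE_iff extensional_def restrict_def fun_eq_iff)
    with zero show ?case by (simp only:)
  next
    case (insert j F)
    let ?y = "\<lambda>l\<in>J. if l = j then \<zero>\<^bsub>M l\<^esub> else x l"
    let ?e = "\<lambda>l\<in>J. if l = j then x j else \<zero>\<^bsub>M l\<^esub>"
    from insert.prems(2) have j: "j \<in> J" by auto
    have e: "{l \<in> J. ?e l \<noteq> \<zero>\<^bsub>M l\<^esub>} \<subseteq> {j}" by auto
    have y: "{l \<in> J. ?y l \<noteq> \<zero>\<^bsub>M l\<^esub>} = F"
      using insert.prems(2) insert.hyps(2) by auto
    have xj: "x j \<in> carrier (M j)" using insert.prems(1) j by (auto simp: C)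
    have yc: "?y \<in> carrier (direct_sum J M)"
      using insert.prems(1) insert.hyps(1) y module_zero_closed[OF M] by (auto simp: C PiE_iff)
    have ec: "?e \<in> carrier (direct_sum J M)"
      using insert.prems(1) finite_subset[OF e] module_zero_closed[OF M] xj by (auto simp: C PiE_iff)
    have "x = ?e \<oplus>\<^bsub>direct_sum J M\<^esub> ?y"
    proof
      fix l
      show "x l = (?e \<oplus>\<^bsub>direct_sum J M\<^esub> ?y) l"
      proof (cases "l \<in> J")
        case True
        then interpret abelian_monoid "M l" using M by (simp add: module_def abelian_group_def)
        have "x l \<in> carrier (M l)" using insert.prems(1) True by (auto simp: C)
        then show ?thesis using True j l_zero r_zero by (cases "l = j") simp_all
      next
        case False
        then show ?thesis using insert.prems(1) by (auto simp: C)
      qed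
    qed
    with add[OF j xj yc ec insert.IH[OF yc y]] show ?case by simp
  qed
  then show ?thesis using x C by auto
qed

text \<open>The test object \<open>T\<close> may live over any type.\<close>

lemma seq_coproduct_universal:
  assumes "cring K" and W: "\<And>j. j \<in> J \<Longrightarrow> seq_object K (W j)" and T: "seq_object K T"
    and g: "\<And>j. j \<in> J \<Longrightarrow> g j \<in> seq_morphisms K (W j) T"
  shows "\<exists>h\<in>seq_morphisms K (seq_coproduct J W) T.
           (\<forall>j\<in>J. \<forall>i. \<forall>x\<in>carrier (seq_space (W j) i). h i (seq_inclusion J W j i x) = g j i x) \<and>
           (\<forall>h'\<in>seq_morphisms K (seq_coproduct J W) T.
              (\<forall>j\<in>J. \<forall>i. \<forall>x\<in>carrier (seq_space (W j) i). h' i (seq_inclusion J W j i x) = g j i x) \<longrightarrow>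
              (\<forall>i. \<forall>x\<in>carrier (seq_space (seq_coproduct J W) i). h' i x = h i x))"
proof -
  have M: "module K (seq_space (W j) i)" if "j \<in> J" for i j
    using seq_objectD(1)[OF W[OF that]] .
  note MT = seq_objectD(1)[OF T]
  let ?S = "\<lambda>i. direct_sum J (\<lambda>j. seq_space (W j) i)"
  let ?supp = "\<lambda>i x. {j \<in> J. x j \<noteq> \<zero>\<^bsub>seq_space (W j) i\<^esub>}"
  define h where "h i x = (\<Oplus>\<^bsub>seq_space T i\<^esub>j\<in>?supp i x. g j i (x j))" for i x
  have C: "carrier (?S i) = {x \<in> \<Pi>\<^sub>E j\<in>J. carrier (seq_space (W j) i). finite (?supp i x)}" for i
    by (rule carrier_direct_sum) (rule M)
  have gl: "j \<in> J \<Longrightarrow> g j i \<in> linear_maps K (seq_space (W j) i) (seq_space T i)" for i j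
    using g by (auto simp: seq_morphisms_def)
  have gz: "j \<in> J \<Longrightarrow> g j i \<zero>\<^bsub>seq_space (W j) i\<^esub> = \<zero>\<^bsub>seq_space T i\<^esub>" for i j
    using linear_maps_zero[OF M MT gl] .
  have S: "module K (?S i)" for i by (rule module_direct_sum[OF \<open>cring K\<close> M])
  have gc: "x \<in> carrier (?S i) \<Longrightarrow> j \<in> J \<Longrightarrow> g j i (x j) \<in> carrier (seq_space T i)" for i j x
    using linear_mapsD(1)[OF gl] by (auto simp: C PiE_iff)
  have hF: "h i x = (\<Oplus>\<^bsub>seq_space T i\<^esub>j\<in>F. g j i (x j))"
    if "x \<in> carrier (?S i)" "finite F" "F \<subseteq> J" "?supp i x \<subseteq> F" for i x F
  proof -
    interpret T: abelian_monoid "seq_space T i" using MT by (simp add: module_def abelian_group_def)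
    show ?thesis unfolding h_def
      using that gz gc by (intro T.add.finprod_mono_neutral_cong_left) auto
  qed
  have fin: "x \<in> carrier (?S i) \<Longrightarrow> finite (?supp i x)" for x i by (simp add: C)
  have add: "h i (x \<oplus>\<^bsub>?S i\<^esub> y) = h i x \<oplus>\<^bsub>seq_space T i\<^esub> h i y"
    if x: "x \<in> carrier (?S i)" and y: "y \<in> carrier (?S i)" for i x y
  proof -
    interpret T: abelian_monoid "seq_space T i" using MT by (simp add: module_def abelian_group_def)
    interpret S: module K "?S i" by (rule S)
    let ?F = "?supp i x \<union> ?supp i y"
    have s: "?supp i (x \<oplus>\<^bsub>?S i\<^esub> y) \<subseteq> ?F"
      using M by (auto simp: module_def abelian_group_def abelian_monoid.l_zero abelian_monoid.zero_closed)
    have xy: "x \<oplus>\<^bsub>?S i\<^esub> y \<in> carrier (?S i)" using x y by (rule S.a_closed)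
    have "h i (x \<oplus>\<^bsub>?S i\<^esub> y) = (\<Oplus>\<^bsub>seq_space T i\<^esub>j\<in>?F. g j i ((x \<oplus>\<^bsub>?S i\<^esub> y) j))"
      using fin[OF x] fin[OF y] xy s by (intro hF) auto
    also have "\<dots> = (\<Oplus>\<^bsub>seq_space T i\<^esub>j\<in>?F. g j i (x j) \<oplus>\<^bsub>seq_space T i\<^esub> g j i (y j))"
      using x y gc
      by (intro T.finsum_cong') (auto simp: C PiE_iff linear_mapsD(2)[OF gl])
    also have "\<dots> = (\<Oplus>\<^bsub>seq_space T i\<^esub>j\<in>?F. g j i (x j)) \<oplus>\<^bsub>seq_space T i\<^esub> (\<Oplus>\<^bsub>seq_space T i\<^esub>j\<in>?F. g j i (y j))"
      using gc x y by (intro T.finsum_addf) auto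
    also have "\<dots> = h i x \<oplus>\<^bsub>seq_space T i\<^esub> h i y"
      using fin[OF x] fin[OF y] x y by (subst (1 2) hF[of _ _ ?F]) auto
    finally show ?thesis .
  qed
  have hz: "h i \<zero>\<^bsub>?S i\<^esub> = \<zero>\<^bsub>seq_space T i\<^esub>" for i
  proof -
    interpret T: abelian_monoid "seq_space T i" using MT by (simp add: module_def abelian_group_def)
    have "?supp i \<zero>\<^bsub>?S i\<^esub> = {}" by auto
    then show ?thesis unfolding h_def by (simp only: T.finsum_empty)
  qed
  have hinc: "h i (\<lambda>l\<in>J. if l = j then u else \<zero>\<^bsub>seq_space (W l) i\<^esub>) = g j i u"
    if "j \<in> J" "u \<in> carrier (seq_space (W j) i)"
      "(\<lambda>l\<in>J. if l = j then u else \<zero>\<^bsub>seq_space (W l) i\<^esub>) \<in> carrier (?S i)" for i j u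
  proof -
    interpret T: abelian_monoid "seq_space T i" using MT by (simp add: module_def abelian_group_def)
    have "h i (\<lambda>l\<in>J. if l = j then u else \<zero>\<^bsub>seq_space (W l) i\<^esub>) =
      (\<Oplus>\<^bsub>seq_space T i\<^esub>j'\<in>{j}. g j' i ((\<lambda>l\<in>J. if l = j then u else \<zero>\<^bsub>seq_space (W l) i\<^esub>) j'))"
      using that by (intro hF) auto
    also have "\<dots> = g j i u"
      using that linear_mapsD(1)[OF gl] by simp
    finally show ?thesis .
  qed
  have hc: "x \<in> carrier (?S i) \<Longrightarrow> h i x \<in> carrier (seq_space T i)" for i x
  proof -
    interpret T: abelian_monoid "seq_space T i" using MT by (simp add: module_def abelian_group_def)
    show "x \<in> carrier (?S i) \<Longrightarrow> h i x \<in> carrier (seq_space T i)"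
      unfolding h_def using gc by (intro T.finsum_closed) auto
  qed
  have hl: "h i \<in> linear_maps K (?S i) (seq_space T i)" for i
  proof (rule linear_mapsI)
    fix a x assume a: "a \<in> carrier K" and x: "x \<in> carrier (?S i)"
    interpret T: module K "seq_space T i" by (rule MT)
    interpret S: module K "?S i" by (rule S)
    show "h i (a \<odot>\<^bsub>?S i\<^esub> x) = a \<odot>\<^bsub>seq_space T i\<^esub> h i x"
    proof (rule direct_sum_induct[where J = J and K = K and M = "\<lambda>j. seq_space (W j) i" and x = x and P = "\<lambda>x. h i (a \<odot>\<^bsub>?S i\<^esub> x) = a \<odot>\<^bsub>seq_space T i\<^esub> h i x"], goal_cases)
      case (1 j) then show ?case by (rule M)
    next
      case 2 show ?case by (rule x)
    next
      case 3
      have "a \<odot>\<^bsub>?S i\<^esub> \<zero>\<^bsub>?S i\<^esub> = \<zero>\<^bsub>?S i\<^esub>" using a by (rule S.smult_r_null)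
      then show ?case using a hz by (simp only: T.smult_r_null)
    next
      case (4 j u y)
      let ?e = "\<lambda>u. \<lambda>l\<in>J. if l = j then u else \<zero>\<^bsub>seq_space (W l) i\<^esub>"
      have ae: "a \<odot>\<^bsub>?S i\<^esub> ?e u = ?e (a \<odot>\<^bsub>seq_space (W j) i\<^esub> u)"
        using module.smult_r_null[OF M] a by (auto intro!: restrict_ext)
      have au: "a \<odot>\<^bsub>seq_space (W j) i\<^esub> u \<in> carrier (seq_space (W j) i)"
        using module.smult_closed[OF M] a 4 by auto
      have aec: "?e (a \<odot>\<^bsub>seq_space (W j) i\<^esub> u) \<in> carrier (?S i)"
        unfolding ae[symmetric] using 4 a by (intro S.smult_closed)
      have "h i (a \<odot>\<^bsub>?S i\<^esub> (?e u \<oplus>\<^bsub>?S i\<^esub> y)) = h i (?e (a \<odot>\<^bsub>seq_space (W j) i\<^esub> u) \<oplus>\<^bsub>?S i\<^esub> (a \<odot>\<^bsub>?S i\<^esub> y))"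
        unfolding ae[symmetric] using 4 a by (simp only: S.smult_r_distr)
      also have "\<dots> = g j i (a \<odot>\<^bsub>seq_space (W j) i\<^esub> u) \<oplus>\<^bsub>seq_space T i\<^esub> (a \<odot>\<^bsub>seq_space T i\<^esub> h i y)"
        using add[OF aec S.smult_closed[OF a 4(3)]] hinc[OF 4(1) au aec] 4(5) by simp
      also have "\<dots> = a \<odot>\<^bsub>seq_space T i\<^esub> (g j i u \<oplus>\<^bsub>seq_space T i\<^esub> h i y)"
        using a 4(1,2) linear_mapsD(1,3)[OF gl[OF 4(1)]] hc[OF 4(3)] by (simp add: T.smult_r_distr)
      also have "\<dots> = a \<odot>\<^bsub>seq_space T i\<^esub> h i (?e u \<oplus>\<^bsub>?S i\<^esub> y)"
        using add[OF 4(4) 4(3)] hinc[OF 4(1,2,4)] by simp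
      finally show ?case .
    qed
  qed (fact hc add)+
  have unique: "h' x = h'' x"
    if x: "x \<in> carrier (?S i)" and h': "h' \<in> linear_maps K (?S i) (seq_space T k)" and h'': "h'' \<in> linear_maps K (?S i) (seq_space T k)"
      and eq: "\<And>j u. \<lbrakk>j \<in> J; u \<in> carrier (seq_space (W j) i)\<rbrakk> \<Longrightarrow>
        h' (seq_inclusion J W j i u) = h'' (seq_inclusion J W j i u)"
    for i k x h' h''
  proof (rule direct_sum_induct[where J = J and K = K and M = "\<lambda>j. seq_space (W j) i" and x = x and P = "\<lambda>x. h' x = h'' x"], goal_cases)
    case (1 j) then show ?case by (rule M)
  next
    case 2 show ?case by (rule x)
  next
    case 3
    show ?case using linear_maps_zero[OF S MT h'] linear_maps_zero[OF S MT h''] by (simp only:)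
  next
    case (4 j u y)
    then show ?case
      using linear_mapsD(2)[OF h' 4(4,3)] linear_mapsD(2)[OF h'' 4(4,3)] eq[OF 4(1,2)]
      by (simp only: seq_inclusion_def)
  qed
  have incm: "seq_inclusion J W j \<in> seq_morphisms K (W j) (seq_coproduct J W)"
    if "j \<in> J" for j
    using \<open>cring K\<close> W that by (rule seq_inclusion_morphism)
  have inc: "seq_inclusion J W j i u \<in> carrier (?S i)"
    if "j \<in> J" "u \<in> carrier (seq_space (W j) i)" for i j u
    using incm[OF that(1)] that(2) linear_mapsD(1)
    by (fastforce simp: seq_morphisms_def seq_coproduct_def)
  have hincl: "h i (seq_inclusion J W j i u) = g j i u"
    if "j \<in> J" "u \<in> carrier (seq_space (W j) i)" for i j u
    using hinc[OF that] inc[OF that] by (simp only: seq_inclusion_def)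
  have comm: "h (i + 1) (\<lambda>j\<in>J. seq_diff (W j) i (x j)) = seq_diff T i (h i x)"
    if x: "x \<in> carrier (?S i)" for i x
  proof (rule unique[OF x])
    have d: "(\<lambda>x. \<lambda>j\<in>J. seq_diff (W j) i (x j)) \<in> linear_maps K (?S i) (?S (i + 1))"
      by (intro linear_maps_direct_sum M seq_objectD(2) W)
    show "(\<lambda>x. h (i + 1) (\<lambda>j\<in>J. seq_diff (W j) i (x j))) \<in> linear_maps K (?S i) (seq_space T (i + 1))"
      using linear_maps_comp[OF d hl] .
    show "(\<lambda>x. seq_diff T i (h i x)) \<in> linear_maps K (?S i) (seq_space T (i + 1))"
      using linear_maps_comp[OF hl seq_objectD(2)[OF T]] .
    fix j u assume j: "j \<in> J" and u: "u \<in> carrier (seq_space (W j) i)"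
    have "(\<lambda>l\<in>J. seq_diff (W l) i (seq_inclusion J W j i u l)) =
        seq_inclusion J W j (i + 1) (seq_diff (W j) i u)"
      using incm[OF j] u
      by (simp add: seq_morphisms_def seq_coproduct_def)
    moreover have "g j (i + 1) (seq_diff (W j) i u) = seq_diff T i (g j i u)"
      using g[OF j] u by (simp add: seq_morphisms_def)
    ultimately show "h (i + 1) (\<lambda>l\<in>J. seq_diff (W l) i (seq_inclusion J W j i u l)) =
        seq_diff T i (h i (seq_inclusion J W j i u))"
      using hincl[OF j u] hincl[OF j linear_mapsD(1)[OF seq_objectD(2)[OF W[OF j]] u]] by simp
  qed
  show ?thesis
  proof (intro bexI[of _ h] conjI ballI allI impI)
    show "h \<in> seq_morphisms K (seq_coproduct J W) T"
      using hl comm by (simp add: seq_morphisms_def seq_coproduct_def)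
    fix h' i x
    assume h': "h' \<in> seq_morphisms K (seq_coproduct J W) T"
      and eq: "\<forall>j\<in>J. \<forall>i. \<forall>x\<in>carrier (seq_space (W j) i). h' i (seq_inclusion J W j i x) = g j i x"
      and x: "x \<in> carrier (seq_space (seq_coproduct J W) i)"
    show "h' i x = h i x"
    proof (rule unique[OF _ _ hl])
      show "x \<in> carrier (?S i)" using x by (simp add: seq_coproduct_def)
      show "h' i \<in> linear_maps K (?S i) (seq_space T i)"
        using h' by (simp add: seq_morphisms_def seq_coproduct_def)
    qed (use eq hincl in auto)
  qed (use hincl in auto)
qed

subsection \<open>Independence of the chosen types\<close>

lemma seq_object_interval:
  assumes "cring K" shows "seq_object K (interval_seq K a b)"
proof -
  interpret cring K by fact
  have le: "a \<le> Fin i \<Longrightarrow> a \<le> Fin (i + 1)" "Fin i < b \<Longrightarrow> Fin (i + 1) \<le> b" "Fin i < b \<Longrightarrow> Fin i \<le> b" for i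
    by (cases a; cases b; simp)+
  have "module K (seq_space (interval_seq K a b) i)" for i
    by (intro moduleI abelian_groupI \<open>cring K\<close>)
       (auto simp: interval_seq_def l_distr r_distr m_assoc a_ac split: if_splits
         intro!: bexI[of _ "\<ominus>\<^bsub>K\<^esub> _"] l_neg)
  moreover have "seq_diff (interval_seq K a b) i \<in>
      linear_maps K (seq_space (interval_seq K a b) i) (seq_space (interval_seq K a b) (i + 1))" for i
    by (rule linear_mapsI) (auto simp: interval_seq_def le minus_add r_minus split: if_splits)
  ultimately show ?thesis by (simp add: seq_object_def)
qed

lemma seq_nonzero_interval:
  assumes "field K" "interval_ends a b" shows "\<not> seq_zero (interval_seq K a b)"
proof -
  interpret field K by fact
  define i where "i = (case a of Fin k \<Rightarrow> k | _ \<Rightarrow> (case b of Fin l \<Rightarrow> l | _ \<Rightarrow> 0))"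
  have "a \<le> Fin i" "Fin i \<le> b"
    using assms(2) by (cases a; cases b; simp add: interval_ends_def i_def)+
  then have "carrier (seq_space (interval_seq K a b) i) = carrier K"
    by (simp add: interval_seq_def)
  moreover have "\<zero>\<^bsub>seq_space (interval_seq K a b) i\<^esub> = \<zero>\<^bsub>K\<^esub>"
    by (simp add: interval_seq_def)
  moreover have "carrier K \<noteq> {\<zero>\<^bsub>K\<^esub>}"
    using one_closed one_not_zero by blast
  ultimately show ?thesis
    unfolding seq_zero_def by (intro notI) (drule spec[of _ i], simp)
qed

lemma seq_morphismsD:
  assumes "f \<in> seq_morphisms K V W"
  shows "f i \<in> linear_maps K (seq_space V i) (seq_space W i)"
    and "x \<in> carrier (seq_space V i) \<Longrightarrow> f i x \<in> carrier (seq_space W i)"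
    and "x \<in> carrier (seq_space V i) \<Longrightarrow> f (i + 1) (seq_diff V i x) = seq_diff W i (f i x)"
proof -
  show l: "f i \<in> linear_maps K (seq_space V i) (seq_space W i)" for i
    using assms by (simp add: seq_morphisms_def)
  show "x \<in> carrier (seq_space V i) \<Longrightarrow> f i x \<in> carrier (seq_space W i)"
    by (rule linear_mapsD(1)[OF l])
  show "x \<in> carrier (seq_space V i) \<Longrightarrow> f (i + 1) (seq_diff V i x) = seq_diff W i (f i x)"
    using assms by (simp add: seq_morphisms_def)
qed

lemma seq_morphisms_comp:
  assumes "f \<in> seq_morphisms K U V" "g \<in> seq_morphisms K V W"
  shows "(\<lambda>i x. g i (f i x)) \<in> seq_morphisms K U W"
  unfolding seq_morphisms_def
  using linear_maps_comp[OF seq_morphismsD(1)[OF assms(1)] seq_morphismsD(1)[OF assms(2)]]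
    seq_morphismsD(2,3)[OF assms(1)] seq_morphismsD(3)[OF assms(2)]
  by simp

lemma seq_iso_sym: "seq_iso K V W \<Longrightarrow> seq_iso K W V"
  unfolding seq_iso_def by (elim bexE conjE) (intro bexI conjI; assumption)

lemma seq_iso_trans:
  assumes "seq_iso K U V" "seq_iso K V W" shows "seq_iso K U W"
proof -
  obtain f g where f: "f \<in> seq_morphisms K U V" and g: "g \<in> seq_morphisms K V U"
    and 1: "\<And>i x. x \<in> carrier (seq_space U i) \<Longrightarrow> g i (f i x) = x"
      "\<And>i x. x \<in> carrier (seq_space V i) \<Longrightarrow> f i (g i x) = x"
    using assms(1) unfolding seq_iso_def by blast
  obtain f' g' where f': "f' \<in> seq_morphisms K V W" and g': "g' \<in> seq_morphisms K W V"
    and 2: "\<And>i x. x \<in> carrier (seq_space V i) \<Longrightarrow> g' i (f' i x) = x"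
      "\<And>i x. x \<in> carrier (seq_space W i) \<Longrightarrow> f' i (g' i x) = x"
    using assms(2) unfolding seq_iso_def by blast
  note seq_morphismsD(2)[OF f] seq_morphismsD(2)[OF g']
  then show ?thesis
    unfolding seq_iso_def
    by (intro bexI[OF _ seq_morphisms_comp[OF f f']] bexI[OF _ seq_morphisms_comp[OF g' g]])
       (simp add: 1 2)
qed

lemma seq_zero_iso:
  assumes "seq_object K V" "seq_object K W" "seq_iso K V W" "seq_zero V"
  shows "seq_zero W"
proof -
  obtain f g where f: "f \<in> seq_morphisms K V W" and g: "g \<in> seq_morphisms K W V"
    and 1: "\<And>i x. x \<in> carrier (seq_space W i) \<Longrightarrow> f i (g i x) = x"
    using assms(3) unfolding seq_iso_def by blast
  have "x = \<zero>\<^bsub>seq_space W i\<^esub>" if x: "x \<in> carrier (seq_space W i)" for x i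
  proof -
    have "g i x = \<zero>\<^bsub>seq_space V i\<^esub>"
      using seq_morphismsD(2)[OF g x] assms(4) by (simp add: seq_zero_def)
    then show ?thesis
      using 1[OF x] linear_maps_zero[OF seq_objectD(1)[OF assms(1)] seq_objectD(1)[OF assms(2)]
        seq_morphismsD(1)[OF f]]
      by simp
  qed
  then show ?thesis
    using module_zero_closed[OF seq_objectD(1)[OF assms(2)]] unfolding seq_zero_def by blast
qed

lemma seq_iso_direct_sum:
  assumes h: "bij_betw h J J'"
    and W: "\<And>j. j \<in> J \<Longrightarrow> seq_object K (W j)" and W': "\<And>j. j \<in> J' \<Longrightarrow> seq_object K (W' j)"
    and iso: "\<And>j. j \<in> J \<Longrightarrow> seq_iso K (W j) (W' (h j))"
  shows "seq_iso K (seq_coproduct J W) (seq_coproduct J' W')"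
proof -
  have M: "module K (seq_space (W j) i)" if "j \<in> J" for i j
    using seq_objectD(1)[OF W[OF that]] .
  have M': "module K (seq_space (W' j) i)" if "j \<in> J'" for i j
    using seq_objectD(1)[OF W'[OF that]] .
  have C: "carrier (direct_sum J (\<lambda>j. seq_space (W j) i)) =
      {x \<in> \<Pi>\<^sub>E j\<in>J. carrier (seq_space (W j) i). finite {j \<in> J. x j \<noteq> \<zero>\<^bsub>seq_space (W j) i\<^esub>}}" for i
    by (rule carrier_direct_sum) (rule M)
  have C': "carrier (direct_sum J' (\<lambda>j. seq_space (W' j) i)) =
      {x \<in> \<Pi>\<^sub>E j\<in>J'. carrier (seq_space (W' j) i). finite {j \<in> J'. x j \<noteq> \<zero>\<^bsub>seq_space (W' j) i\<^esub>}}" for i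
    by (rule carrier_direct_sum) (rule M')
  define k where "k = the_inv_into J h"
  have k: "k j \<in> J" "h (k j) = j" if "j \<in> J'" for j
    using h that unfolding k_def bij_betw_def
    by (metis subset_refl the_inv_into_into) (metis bij_betw_def f_the_inv_into_f h that)
  have hj: "h j \<in> J'" "k (h j) = j" if "j \<in> J" for j
    using h that unfolding k_def bij_betw_def by (auto simp: the_inv_into_f_f)
  obtain f g where f: "\<And>j. j \<in> J \<Longrightarrow> f j \<in> seq_morphisms K (W j) (W' (h j))"
    and g: "\<And>j. j \<in> J \<Longrightarrow> g j \<in> seq_morphisms K (W' (h j)) (W j)"
    and gf: "\<And>j i x. \<lbrakk>j \<in> J; x \<in> carrier (seq_space (W j) i)\<rbrakk> \<Longrightarrow> g j i (f j i x) = x"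
    and fg: "\<And>j i x. \<lbrakk>j \<in> J; x \<in> carrier (seq_space (W' (h j)) i)\<rbrakk> \<Longrightarrow> f j i (g j i x) = x"
    using iso unfolding seq_iso_def by metis
  have fl: "f j i \<in> linear_maps K (seq_space (W j) i) (seq_space (W' (h j)) i)" if "j \<in> J" for i j
    using f[OF that] by (simp add: seq_morphisms_def)
  have gl: "g j i \<in> linear_maps K (seq_space (W' (h j)) i) (seq_space (W j) i)" if "j \<in> J" for i j
    using g[OF that] by (simp add: seq_morphisms_def)
  have fz: "f j i \<zero>\<^bsub>seq_space (W j) i\<^esub> = \<zero>\<^bsub>seq_space (W' (h j)) i\<^esub>" if "j \<in> J" for i j
    using linear_maps_zero[OF M[OF that] M'[OF hj(1)[OF that]] fl[OF that]] .
  have gz: "g j i \<zero>\<^bsub>seq_space (W' (h j)) i\<^esub> = \<zero>\<^bsub>seq_space (W j) i\<^esub>" if "j \<in> J" for i j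
    using linear_maps_zero[OF M'[OF hj(1)[OF that]] M[OF that] gl[OF that]] .
  define F where "F i x = (\<lambda>j\<in>J'. f (k j) i (x (k j)))" for i x
  define G where "G i x = (\<lambda>j\<in>J. g j i (x (h j)))" for i x
  have Fc: "F i x \<in> carrier (direct_sum J' (\<lambda>j. seq_space (W' j) i))"
    if x: "x \<in> carrier (direct_sum J (\<lambda>j. seq_space (W j) i))" for x i
  proof -
    have "{j \<in> J'. F i x j \<noteq> \<zero>\<^bsub>seq_space (W' j) i\<^esub>} \<subseteq> h ` {j \<in> J. x j \<noteq> \<zero>\<^bsub>seq_space (W j) i\<^esub>}"
    proof
      fix j assume "j \<in> {j \<in> J'. F i x j \<noteq> \<zero>\<^bsub>seq_space (W' j) i\<^esub>}"
      then have "k j \<in> {j \<in> J. x j \<noteq> \<zero>\<^bsub>seq_space (W j) i\<^esub>}" "j = h (k j)"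
        using k fz[of "k j" i] by (auto simp: F_def)
      then show "j \<in> h ` {j \<in> J. x j \<noteq> \<zero>\<^bsub>seq_space (W j) i\<^esub>}" by blast
    qed
    moreover have "F i x \<in> (\<Pi>\<^sub>E j\<in>J'. carrier (seq_space (W' j) i))"
      unfolding F_def using x k linear_mapsD(1)[OF fl[OF k(1)]] by (fastforce simp: C PiE_iff)
    ultimately show ?thesis using x by (auto simp: C C' intro: finite_subset)
  qed
  have Gc: "G i x \<in> carrier (direct_sum J (\<lambda>j. seq_space (W j) i))"
    if x: "x \<in> carrier (direct_sum J' (\<lambda>j. seq_space (W' j) i))" for x i
  proof -
    have "{j \<in> J. G i x j \<noteq> \<zero>\<^bsub>seq_space (W j) i\<^esub>} \<subseteq> k ` {j \<in> J'. x j \<noteq> \<zero>\<^bsub>seq_space (W' j) i\<^esub>}"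
    proof
      fix j assume "j \<in> {j \<in> J. G i x j \<noteq> \<zero>\<^bsub>seq_space (W j) i\<^esub>}"
      then have "h j \<in> {j \<in> J'. x j \<noteq> \<zero>\<^bsub>seq_space (W' j) i\<^esub>}" "j = k (h j)"
        using hj gz[of j i] by (auto simp: G_def)
      then show "j \<in> k ` {j \<in> J'. x j \<noteq> \<zero>\<^bsub>seq_space (W' j) i\<^esub>}" by blast
    qed
    moreover have "G i x \<in> (\<Pi>\<^sub>E j\<in>J. carrier (seq_space (W j) i))"
      unfolding G_def using x hj linear_mapsD(1)[OF gl] by (auto simp: C' PiE_iff)
    ultimately show ?thesis using x by (auto simp: C C' intro: finite_subset)
  qed
  have "F \<in> seq_morphisms K (seq_coproduct J W) (seq_coproduct J' W')"
    unfolding seq_morphisms_def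
  proof (intro CollectI conjI allI ballI)
    fix i
    show "F i \<in> linear_maps K (seq_space (seq_coproduct J W) i) (seq_space (seq_coproduct J' W') i)"
      unfolding seq_coproduct_def seq.simps
    proof (rule linear_mapsI)
      fix x y assume "x \<in> carrier (direct_sum J (\<lambda>j. seq_space (W j) i))"
        "y \<in> carrier (direct_sum J (\<lambda>j. seq_space (W j) i))"
      then have "j \<in> J \<Longrightarrow> x j \<in> carrier (seq_space (W j) i)" "j \<in> J \<Longrightarrow> y j \<in> carrier (seq_space (W j) i)" for j
        by (auto simp: C)
      then show "F i (x \<oplus>\<^bsub>direct_sum J (\<lambda>j. seq_space (W j) i)\<^esub> y) =
          F i x \<oplus>\<^bsub>direct_sum J' (\<lambda>j. seq_space (W' j) i)\<^esub> F i y"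
        unfolding F_def using k linear_mapsD(2)[OF fl[OF k(1)]] by (auto intro!: restrict_ext)
    next
      fix a x assume a: "a \<in> carrier K" and "x \<in> carrier (direct_sum J (\<lambda>j. seq_space (W j) i))"
      then have "j \<in> J \<Longrightarrow> x j \<in> carrier (seq_space (W j) i)" for j
        by (auto simp: C)
      then show "F i (a \<odot>\<^bsub>direct_sum J (\<lambda>j. seq_space (W j) i)\<^esub> x) =
          a \<odot>\<^bsub>direct_sum J' (\<lambda>j. seq_space (W' j) i)\<^esub> F i x"
        unfolding F_def using a k linear_mapsD(3)[OF fl[OF k(1)]] by (auto intro!: restrict_ext)
    qed (rule Fc)
    fix x assume "x \<in> carrier (seq_space (seq_coproduct J W) i)"
    then have "j \<in> J \<Longrightarrow> x j \<in> carrier (seq_space (W j) i)" for j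
      by (auto simp: C seq_coproduct_def)
    moreover have "x \<in> carrier (seq_space (W j) i) \<Longrightarrow> j \<in> J \<Longrightarrow>
        f j (i + 1) (seq_diff (W j) i x) = seq_diff (W' (h j)) i (f j i x)" for x j
      using f by (auto simp: seq_morphisms_def)
    ultimately show "F (i + 1) (seq_diff (seq_coproduct J W) i x) = seq_diff (seq_coproduct J' W') i (F i x)"
      using k by (auto simp: F_def seq_coproduct_def intro!: restrict_ext)
  qed
  moreover have "G \<in> seq_morphisms K (seq_coproduct J' W') (seq_coproduct J W)"
    unfolding seq_morphisms_def
  proof (intro CollectI conjI allI ballI)
    fix i
    show "G i \<in> linear_maps K (seq_space (seq_coproduct J' W') i) (seq_space (seq_coproduct J W) i)"
      unfolding seq_coproduct_def seq.simps
    proof (rule linear_mapsI)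
      fix x y assume "x \<in> carrier (direct_sum J' (\<lambda>j. seq_space (W' j) i))"
        "y \<in> carrier (direct_sum J' (\<lambda>j. seq_space (W' j) i))"
      then have "j \<in> J' \<Longrightarrow> x j \<in> carrier (seq_space (W' j) i)" "j \<in> J' \<Longrightarrow> y j \<in> carrier (seq_space (W' j) i)" for j
        by (auto simp: C')
      then show "G i (x \<oplus>\<^bsub>direct_sum J' (\<lambda>j. seq_space (W' j) i)\<^esub> y) =
          G i x \<oplus>\<^bsub>direct_sum J (\<lambda>j. seq_space (W j) i)\<^esub> G i y"
        unfolding G_def using hj linear_mapsD(2)[OF gl] by (auto intro!: restrict_ext)
    next
      fix a x assume a: "a \<in> carrier K" and "x \<in> carrier (direct_sum J' (\<lambda>j. seq_space (W' j) i))"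
      then have "j \<in> J' \<Longrightarrow> x j \<in> carrier (seq_space (W' j) i)" for j
        by (auto simp: C')
      then show "G i (a \<odot>\<^bsub>direct_sum J' (\<lambda>j. seq_space (W' j) i)\<^esub> x) =
          a \<odot>\<^bsub>direct_sum J (\<lambda>j. seq_space (W j) i)\<^esub> G i x"
        unfolding G_def using a hj linear_mapsD(3)[OF gl] by (auto intro!: restrict_ext)
    qed (rule Gc)
    fix x assume "x \<in> carrier (seq_space (seq_coproduct J' W') i)"
    then have "j \<in> J' \<Longrightarrow> x j \<in> carrier (seq_space (W' j) i)" for j
      by (auto simp: C' seq_coproduct_def)
    moreover have "x \<in> carrier (seq_space (W' (h j)) i) \<Longrightarrow> j \<in> J \<Longrightarrow>
        g j (i + 1) (seq_diff (W' (h j)) i x) = seq_diff (W j) i (g j i x)" for x j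
      using g by (auto simp: seq_morphisms_def)
    ultimately show "G (i + 1) (seq_diff (seq_coproduct J' W') i x) = seq_diff (seq_coproduct J W) i (G i x)"
      using hj by (auto simp: G_def seq_coproduct_def intro!: restrict_ext)
  qed
  moreover have "G i (F i x) = x" if "x \<in> carrier (seq_space (seq_coproduct J W) i)" for i x
    using that hj gf by (auto simp: F_def G_def seq_coproduct_def C PiE_iff extensional_def fun_eq_iff)
  moreover have "F i (G i y) = y" if "y \<in> carrier (seq_space (seq_coproduct J' W') i)" for i y
  proof
    fix j show "F i (G i y) j = y j"
      using that k[of j] fg[of "k j" "y j" i]
      by (cases "j \<in> J'") (auto simp: F_def G_def seq_coproduct_def C' PiE_iff extensional_def)
  qed
  ultimately show ?thesis unfolding seq_iso_def by blast
qed

definition seq_transport :: "(int \<Rightarrow> 'w \<Rightarrow> 'v) \<Rightarrow> ('k, 'w) seq \<Rightarrow> ('k, 'v) seq" where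
  "seq_transport e W =
     (let r = (\<lambda>i. inv_into (carrier (seq_space W i)) (e i)) in
      \<lparr>seq_space = (\<lambda>i. \<lparr>carrier = e i ` carrier (seq_space W i),
         monoid.mult = (\<lambda>x y. undefined), one = undefined,
         zero = e i \<zero>\<^bsub>seq_space W i\<^esub>,
         add = (\<lambda>x y. e i (r i x \<oplus>\<^bsub>seq_space W i\<^esub> r i y)),
         smult = (\<lambda>a x. e i (a \<odot>\<^bsub>seq_space W i\<^esub> r i x))\<rparr>),
       seq_diff = (\<lambda>i x. e (i + 1) (seq_diff W i (r i x)))\<rparr>)"

lemma seq_transport:
  assumes W: "seq_object K W" and e: "\<And>i. inj_on (e i) (carrier (seq_space W i))"
  shows "seq_object K (seq_transport e W)" and "seq_iso K W (seq_transport e W)"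
proof -
  let ?T = "seq_transport e W"
  let ?r = "\<lambda>i. inv_into (carrier (seq_space W i)) (e i)"
  have r: "x \<in> carrier (seq_space W i) \<Longrightarrow> ?r i (e i x) = x" for i x
    by (rule inv_into_f_f[OF e])
  have M: "module K (seq_space W i)" for i using seq_objectD(1)[OF W] .
  then have "cring K" by (simp add: module_def)
  note d = linear_mapsD[OF seq_objectD(2)[OF W]]
  have "module K (seq_space ?T i)" for i
  proof -
    interpret module K "seq_space W i" by (rule M)
    have neg: "\<exists>y\<in>carrier (seq_space W i). e i (x \<oplus>\<^bsub>seq_space W i\<^esub> y) = e i \<zero>\<^bsub>seq_space W i\<^esub>"
      if "x \<in> carrier (seq_space W i)" for x
      using that M.r_neg M.a_inv_closed by metis
    show ?thesis
      by (intro moduleI abelian_groupI \<open>cring K\<close>)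
         (auto simp: seq_transport_def Let_def r neg M.a_ac smult_l_distr smult_r_distr smult_assoc1)
  qed
  moreover have "seq_diff ?T i \<in> linear_maps K (seq_space ?T i) (seq_space ?T (i + 1))" for i
  proof -
    interpret module K "seq_space W i" by (rule M)
    show ?thesis by (rule linear_mapsI) (auto simp: seq_transport_def Let_def r d)
  qed
  ultimately show "seq_object K ?T" by (simp add: seq_object_def)
  have "e \<in> seq_morphisms K W ?T"
    by (auto simp: seq_morphisms_def seq_transport_def Let_def r intro!: linear_mapsI)
  moreover have "?r \<in> seq_morphisms K ?T W"
    unfolding seq_morphisms_def
  proof (intro CollectI conjI allI ballI)
    fix i
    interpret module K "seq_space W i" by (rule M)
    show "?r i \<in> linear_maps K (seq_space ?T i) (seq_space W i)"
      by (rule linear_mapsI) (auto simp: seq_transport_def Let_def r)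
  qed (auto simp: seq_transport_def Let_def r d)
  moreover have "(\<forall>i. \<forall>x\<in>carrier (seq_space W i). ?r i (e i x) = x) \<and>
    (\<forall>i. \<forall>y\<in>carrier (seq_space ?T i). e i (?r i y) = y)"
    by (auto simp: seq_transport_def Let_def r)
  ultimately show "seq_iso K W ?T" unfolding seq_iso_def by (intro bexI[of _ e] bexI[of _ ?r])
qed

text \<open>Summands embed; distinct summands meet in zero.\<close>

lemma seq_summand_embedding:
  assumes "cring K" and W: "\<And>j. j \<in> J \<Longrightarrow> seq_object K (W j)"
    and iso: "seq_iso K (V :: ('k, 'v) seq) (seq_coproduct J W)"
  obtains e :: "'j \<Rightarrow> int \<Rightarrow> 'w \<Rightarrow> 'v"
  where "\<And>j i. j \<in> J \<Longrightarrow> inj_on (e j i) (carrier (seq_space (W j) i))"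
    and "\<And>j l i x y. \<lbrakk>j \<in> J; l \<in> J; x \<in> carrier (seq_space (W j) i); y \<in> carrier (seq_space (W l) i);
       x \<noteq> \<zero>\<^bsub>seq_space (W j) i\<^esub>; e j i x = e l i y\<rbrakk> \<Longrightarrow> j = l"
proof -
  obtain f g where g: "g \<in> seq_morphisms K (seq_coproduct J W) V"
    and fg: "\<And>i x. x \<in> carrier (seq_space (seq_coproduct J W) i) \<Longrightarrow> f i (g i x) = x"
    using iso unfolding seq_iso_def by blast
  define e where "e j i x = g i (seq_inclusion J W j i x)" for j i x
  have "seq_inclusion J W j i x \<in> carrier (seq_space (seq_coproduct J W) i)"
    if "j \<in> J" "x \<in> carrier (seq_space (W j) i)" for j i x
  proof -
    have "seq_inclusion J W j \<in> seq_morphisms K (W j) (seq_coproduct J W)"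
      using \<open>cring K\<close> W that(1) by (rule seq_inclusion_morphism)
    then show ?thesis using that(2) by (auto simp: seq_morphisms_def dest: linear_mapsD(1))
  qed
  then have eq: "seq_inclusion J W j i x = seq_inclusion J W l i y"
    if "j \<in> J" "l \<in> J" "x \<in> carrier (seq_space (W j) i)" "y \<in> carrier (seq_space (W l) i)"
      "e j i x = e l i y" for j l i x y
    using that fg unfolding e_def by metis
  show thesis
  proof
    show "inj_on (e j i) (carrier (seq_space (W j) i))" if "j \<in> J" for j i
    proof (rule inj_onI)
      fix x y assume "x \<in> carrier (seq_space (W j) i)" "y \<in> carrier (seq_space (W j) i)" "e j i x = e j i y"
      from fun_cong[OF eq[OF that that this], of j] show "x = y" using that by (simp add: seq_inclusion_def)
    qed
    show "j = l" if "j \<in> J" "l \<in> J" "x \<in> carrier (seq_space (W j) i)" "y \<in> carrier (seq_space (W l) i)"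
      "x \<noteq> \<zero>\<^bsub>seq_space (W j) i\<^esub>" "e j i x = e l i y" for j l i x y
      using fun_cong[OF eq[OF that(1-4,6)], of j] that by (auto simp: seq_inclusion_def split: if_splits)
  qed
qed

lemma indecomposable_any_type:
  fixes V :: "('k, 'v) seq" and W1 W2 :: "('k, 'w) seq"
  assumes "cring K" "indecomposable K V"
    and W: "seq_object K W1" "seq_object K W2" and iso: "seq_iso K V (seq_coproduct UNIV (\<lambda>b::bool. if b then W1 else W2))"
  shows "seq_zero W1 \<or> seq_zero W2"
proof (rule ccontr)
  assume nz: "\<not> (seq_zero W1 \<or> seq_zero W2)"
  let ?W = "\<lambda>b::bool. if b then W1 else W2"
  have ob: "seq_object K (?W b)" for b using W by simp
  obtain e :: "bool \<Rightarrow> int \<Rightarrow> 'w \<Rightarrow> 'v"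
    where e: "\<And>j i. inj_on (e j i) (carrier (seq_space (?W j) i))"
    using seq_summand_embedding[OF \<open>cring K\<close> ob iso] by (metis UNIV_I)
  let ?T1 = "seq_transport (e True) W1" and ?T2 = "seq_transport (e False) W2"
  have t1: "seq_object K ?T1" "seq_iso K W1 ?T1"
    using seq_transport[OF W(1), of "e True"] e[of True] by auto
  have t2: "seq_object K ?T2" "seq_iso K W2 ?T2"
    using seq_transport[OF W(2), of "e False"] e[of False] by auto
  have "\<not> seq_zero ?T1" "\<not> seq_zero ?T2"
    using nz seq_zero_iso[OF t1(1) W(1) seq_iso_sym[OF t1(2)]]
      seq_zero_iso[OF t2(1) W(2) seq_iso_sym[OF t2(2)]] by auto
  moreover have "seq_iso K (seq_coproduct UNIV ?W) (seq_coproduct UNIV (\<lambda>b. if b then ?T1 else ?T2))"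
    by (rule seq_iso_direct_sum[of id]) (auto simp: W t1 t2)
  ultimately show False
    using seq_iso_trans[OF iso] \<open>indecomposable K V\<close> t1(1) t2(1) unfolding indecomposable_def by blast
qed

lemma indecomposable_iso:
  assumes "cring K" "indecomposable K V" "seq_object K V'" "seq_iso K V V'"
  shows "indecomposable K V'"
  unfolding indecomposable_def
proof (intro conjI notI)
  show "seq_object K V'" by fact
  show False if "seq_zero V'"
    using that assms seq_zero_iso[OF assms(3) _ seq_iso_sym[OF assms(4)]] by (simp add: indecomposable_def)
  show False if "\<exists>W1 W2. seq_object K W1 \<and> seq_object K W2 \<and> \<not> seq_zero W1 \<and> \<not> seq_zero W2 \<and>
          seq_iso K V' (seq_coproduct UNIV (\<lambda>b::bool. if b then W1 else W2))"
    using that indecomposable_any_type[OF assms(1,2)] seq_iso_trans[OF assms(4)] by metis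
qed

lemma seq_coproduct_reindex:
  fixes V :: "('k, 'v) seq" and W :: "'j \<Rightarrow> ('k, 'w) seq"
  assumes "cring K" and W: "\<And>j. j \<in> J \<Longrightarrow> seq_object K (W j)"
    and nz: "\<And>j. j \<in> J \<Longrightarrow> \<not> seq_zero (W j)" and iso: "seq_iso K V (seq_coproduct J W)"
  obtains h :: "'j \<Rightarrow> int \<times> 'v" and W' :: "'j \<Rightarrow> ('k, 'v) seq"
  where "inj_on h J" "\<And>j. j \<in> J \<Longrightarrow> seq_object K (W' j)" "\<And>j. j \<in> J \<Longrightarrow> seq_iso K (W j) (W' j)"
proof -
  obtain e :: "'j \<Rightarrow> int \<Rightarrow> 'w \<Rightarrow> 'v"
    where inj: "\<And>j i. j \<in> J \<Longrightarrow> inj_on (e j i) (carrier (seq_space (W j) i))"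
    and dis: "\<And>j l i x y. \<lbrakk>j \<in> J; l \<in> J; x \<in> carrier (seq_space (W j) i); y \<in> carrier (seq_space (W l) i);
       x \<noteq> \<zero>\<^bsub>seq_space (W j) i\<^esub>; e j i x = e l i y\<rbrakk> \<Longrightarrow> j = l"
    by (rule seq_summand_embedding[OF \<open>cring K\<close> W iso]) blast+
  have "\<exists>i x. x \<in> carrier (seq_space (W j) i) \<and> x \<noteq> \<zero>\<^bsub>seq_space (W j) i\<^esub>" if "j \<in> J" for j
    using nz[OF that] module_zero_closed[OF seq_objectD(1)[OF W[OF that]]] unfolding seq_zero_def by blast
  then obtain d u where u: "\<And>j. j \<in> J \<Longrightarrow> u j \<in> carrier (seq_space (W j) (d j))"
    "\<And>j. j \<in> J \<Longrightarrow> u j \<noteq> \<zero>\<^bsub>seq_space (W j) (d j)\<^esub>" by metis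
  show thesis
  proof (rule that)
    show "inj_on (\<lambda>j. (d j, e j (d j) (u j))) J"
      by (rule inj_onI) (metis Pair_inject dis u)
    show "seq_object K (seq_transport (e j) (W j))" "seq_iso K (W j) (seq_transport (e j) (W j))"
      if "j \<in> J" for j
      using seq_transport[OF W[OF that] inj[OF that]] by auto
  qed
qed

lemma completely_decomposable_any_type:
  fixes V :: "('k, 'v) seq" and W :: "'j \<Rightarrow> ('k, 'w) seq"
  assumes "cring K" "seq_object K V" and W: "\<And>j. j \<in> J \<Longrightarrow> indecomposable K (W j)"
    and iso: "seq_iso K V (seq_coproduct J W)"
  shows "completely_decomposable K V"
proof -
  have ob: "seq_object K (W j)" and nz: "\<not> seq_zero (W j)" if "j \<in> J" for j
    using W[OF that] by (auto simp: indecomposable_def)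
  obtain h :: "'j \<Rightarrow> int \<times> 'v" and W' :: "'j \<Rightarrow> ('k, 'v) seq"
    where h: "inj_on h J" and W': "\<And>j. j \<in> J \<Longrightarrow> seq_object K (W' j)" "\<And>j. j \<in> J \<Longrightarrow> seq_iso K (W j) (W' j)"
    by (rule seq_coproduct_reindex[OF \<open>cring K\<close> ob nz iso]) blast+
  let ?k = "the_inv_into J h"
  have k: "?k (h j) = j" if "j \<in> J" for j using the_inv_into_f_f[OF h that] .
  have "seq_iso K (seq_coproduct J W) (seq_coproduct (h ` J) (\<lambda>l. W' (?k l)))"
    by (rule seq_iso_direct_sum[of h]) (use h ob W' k in \<open>auto simp: bij_betw_def\<close>)
  moreover have "\<forall>l\<in>h ` J. indecomposable K (W' (?k l))"
    using indecomposable_iso[OF \<open>cring K\<close> W W'] k by auto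
  ultimately show ?thesis
    using \<open>seq_object K V\<close> seq_iso_trans[OF iso] unfolding completely_decomposable_def
    by (intro conjI exI[of _ "h ` J"] exI[of _ "\<lambda>l. W' (?k l)"]) auto
qed

lemma seq_Sd_any_type:
  fixes V :: "('k, 'v) seq" and a b :: "'j \<Rightarrow> int extended"
  assumes "field K" "seq_object K V" and ends: "\<And>j. j \<in> J \<Longrightarrow> interval_ends (a j) (b j)"
    and iso: "seq_iso K V (seq_coproduct J (\<lambda>j. interval_seq K (a j) (b j)))"
  shows "V \<in> seq_Sd K"
proof -
  have "cring K" using \<open>field K\<close> by (simp add: field_def domain_def)
  note ob = seq_object_interval[OF this]
  obtain h :: "'j \<Rightarrow> int \<times> 'v" where h: "inj_on h J"
    by (rule seq_coproduct_reindex[OF \<open>cring K\<close> ob seq_nonzero_interval[OF \<open>field K\<close> ends] iso]) blast+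
  let ?k = "the_inv_into J h"
  have k: "?k (h j) = j" if "j \<in> J" for j using the_inv_into_f_f[OF h that] .
  have refl: "seq_iso K (interval_seq K c d) (interval_seq K c d)" for c d
  proof -
    have "seq_iso K (interval_seq K c d) (seq_transport (\<lambda>i x. x) (interval_seq K c d))"
      by (rule seq_transport(2)[OF ob]) simp
    from seq_iso_trans[OF this seq_iso_sym[OF this]] show ?thesis .
  qed
  have "seq_iso K (seq_coproduct J (\<lambda>j. interval_seq K (a j) (b j)))
      (seq_coproduct (h ` J) (\<lambda>l. interval_seq K (a (?k l)) (b (?k l))))"
    by (rule seq_iso_direct_sum[of h]) (use h ob k refl in \<open>auto simp: bij_betw_def\<close>)
  moreover have "\<forall>l\<in>h ` J. interval_ends (a (?k l)) (b (?k l))" using ends k by auto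
  ultimately show ?thesis
    using \<open>seq_object K V\<close> seq_iso_trans[OF iso] unfolding seq_Sd_def
    by (intro CollectI conjI exI[of _ "h ` J"] exI[of _ "\<lambda>l. a (?k l)"] exI[of _ "\<lambda>l. b (?k l)"]) auto
qed

end

theory Submission
  imports Defs
begin

text \<open>
  Indecomposability is detected by idempotent endomorphisms: \<open>V \<noteq> 0\<close> is indecomposable iff the only
  idempotents are \<open>0\<close> and the identity (\<open>indecomposable_iff_idempotents_trivial\<close>). Endomorphisms of an
  interval object are scalars, so interval objects are indecomposable.

  For the converse, every non-zero \<open>V\<close>, of whatever dimension, has an interval object as a direct
  summand (\<open>nonzero_has_interval_dual_chain\<close>). Such a summand amounts to vectors \<open>x l\<close> and functionals
  \<open>\<phi> l\<close> on \<open>V l\<close>, for \<open>l\<close> in an interval, with \<open>\<phi> l (x l) = 1\<close>, which are compatible with the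
  differential also at the ends of the interval; the idempotent is \<open>v \<mapsto> \<phi>(v) x\<close>. To find it, start
  from one well chosen vector \<open>x\<close>:

  \<^item> If some kernel vector lies outside the image of some \<open>V j\<close>, take it as \<open>x\<close>. The interval is
    finite: it ends at \<open>x\<close>, and it begins at the leftmost degree from which \<open>x\<close> comes. A functional
    that is \<open>1\<close> on \<open>x\<close> and vanishes on the first image missing \<open>x\<close> is pulled back to the left.
  \<^item> If there are non-zero kernel vectors, but all of them lie in all images, take any of them. Each
    preimage of a vector lying in all images again lies in all images, so preimages can be chosen
    forever, and the interval is infinite to the left.
  \<^item> If all differentials are injective, take any non-zero \<open>x\<close>. The left part is found as in the first
    two cases, and the functional extends to the right along the injections forever.

  If \<open>V\<close> is indecomposable, its interval summand is all of \<open>V\<close>. The statement on complete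
  decomposability follows by applying this to each summand.
\<close>

section \<open>Linear functionals and subspaces\<close>

text \<open>
  The ground field as a module over itself, in the module record type; its linear maps from a
  space are the linear functionals.
\<close>

definition scalars :: "('k, 'm) ring_scheme \<Rightarrow> ('k, 'k) module" where
  "scalars K = \<lparr>carrier = carrier K, monoid.mult = (\<otimes>\<^bsub>K\<^esub>), one = \<one>\<^bsub>K\<^esub>,
     zero = \<zero>\<^bsub>K\<^esub>, add = (\<oplus>\<^bsub>K\<^esub>), smult = (\<otimes>\<^bsub>K\<^esub>)\<rparr>"

lemma scalars_simps [simp]:
  "carrier (scalars K) = carrier K" "\<zero>\<^bsub>scalars K\<^esub> = \<zero>\<^bsub>K\<^esub>"
  "x \<oplus>\<^bsub>scalars K\<^esub> y = x \<oplus>\<^bsub>K\<^esub> y" "c \<odot>\<^bsub>scalars K\<^esub> x = c \<otimes>\<^bsub>K\<^esub> x"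
  by (simp_all add: scalars_def)

lemma module_scalars:
  assumes "cring K" shows "module K (scalars K)"
proof -
  interpret cring K by fact
  show ?thesis
    by (intro moduleI abelian_groupI \<open>cring K\<close>)
       (auto simp: l_distr r_distr m_assoc a_ac intro!: bexI[of _ "\<ominus>\<^bsub>K\<^esub> _"] l_neg)
qed

lemma (in module) submodule_criterion:
  assumes H: "H \<subseteq> carrier M" "\<zero>\<^bsub>M\<^esub> \<in> H"
    and add: "\<And>u v. \<lbrakk>u \<in> H; v \<in> H\<rbrakk> \<Longrightarrow> u \<oplus>\<^bsub>M\<^esub> v \<in> H"
    and smult: "\<And>c v. \<lbrakk>c \<in> carrier R; v \<in> H\<rbrakk> \<Longrightarrow> c \<odot>\<^bsub>M\<^esub> v \<in> H"
  shows "submodule H R M"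
proof (rule submoduleI[OF H])
  fix v assume v: "v \<in> H"
  have "\<ominus>\<^bsub>M\<^esub> v = (\<ominus> \<one>) \<odot>\<^bsub>M\<^esub> v"
    using v H(1) by (subst smult_l_minus) auto
  then show "\<ominus>\<^bsub>M\<^esub> v \<in> H" using smult[of "\<ominus> \<one>" v] v by simp
qed (use add smult in auto)

text \<open>
  Zorn's lemma gives a maximal subspace \<open>H\<close> among those containing \<open>N\<close> but not \<open>x\<close>. Maximality
  makes \<open>H\<close> a complement of the line through \<open>x\<close>, since for \<open>v \<notin> H\<close> the span of \<open>H\<close> and \<open>v\<close>
  contains \<open>x\<close>; the coordinate along \<open>x\<close> is the functional.
\<close>

lemma separating_functional:
  assumes "field K" "module K M" and N: "submodule N K M" and x: "x \<in> carrier M" "x \<notin> N"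
  obtains \<phi> where "\<phi> \<in> linear_maps K M (scalars K)" "\<phi> x = \<one>\<^bsub>K\<^esub>" "\<And>v. v \<in> N \<Longrightarrow> \<phi> v = \<zero>\<^bsub>K\<^esub>"
proof -
  interpret K: field K by fact
  interpret module K M by fact
  let ?A = "{H. submodule H K M \<and> N \<subseteq> H \<and> x \<notin> H}"
  have "\<exists>H\<in>?A. \<forall>X\<in>?A. H \<subseteq> X \<longrightarrow> X = H"
  proof (rule subset_Zorn_nonempty)
    show "?A \<noteq> {}" using N x by blast
    fix C assume C0: "C \<noteq> {}" and C: "subset.chain ?A C"
    then have CA: "\<And>H. H \<in> C \<Longrightarrow> submodule H K M \<and> N \<subseteq> H \<and> x \<notin> H"
      by (auto simp: subset.chain_def)
    have "submodule (\<Union>C) K M"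
    proof (rule submodule_criterion)
      show "\<Union>C \<subseteq> carrier M" using CA submoduleE(1) by blast
      obtain H where "H \<in> C" using C0 by blast
      then show "\<zero>\<^bsub>M\<^esub> \<in> \<Union>C"
        using subgroup.one_closed[OF submodule.axioms(1)[of H K M]] CA[of H] by auto
      fix u v assume "u \<in> \<Union>C" "v \<in> \<Union>C"
      then obtain H1 H2 where H12: "H1 \<in> C" "H2 \<in> C" "u \<in> H1" "v \<in> H2" by blast
      then have "H1 \<subseteq> H2 \<or> H2 \<subseteq> H1" using C by (simp add: subset_chain_def)
      then obtain H where "H \<in> C" "u \<in> H" "v \<in> H" using H12 by blast
      then show "u \<oplus>\<^bsub>M\<^esub> v \<in> \<Union>C" using CA submoduleE(5) by blast
    next
      fix c v assume "c \<in> carrier K" "v \<in> \<Union>C"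
      then show "c \<odot>\<^bsub>M\<^esub> v \<in> \<Union>C" using CA submoduleE(4) by blast
    qed
    then show "\<Union>C \<in> ?A" using CA C0 by blast
  qed
  then obtain H where HA: "H \<in> ?A" and maxA: "\<forall>X\<in>?A. H \<subseteq> X \<longrightarrow> X = H" by (rule bexE)
  from HA have H: "submodule H K M" "N \<subseteq> H" "x \<notin> H" by simp_all
  have max: "X = H" if "submodule X K M" "H \<subseteq> X" "x \<notin> X" for X
    using maxA that H(2) by simp
  note HE = submoduleE[OF H(1)]
  have HM: "h \<in> carrier M" if "h \<in> H" for h using that HE(1) by blast
  have H0: "\<zero>\<^bsub>M\<^esub> \<in> H" using subgroup.one_closed[OF submodule.axioms(1)[OF H(1)]] by simp
  have ex: "\<exists>c\<in>carrier K. \<exists>h\<in>H. v = h \<oplus>\<^bsub>M\<^esub> c \<odot>\<^bsub>M\<^esub> x" if v: "v \<in> carrier M" for v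
  proof (cases "v \<in> H")
    case True then show ?thesis using x v by (intro bexI[of _ "\<zero>\<^bsub>K\<^esub>"] bexI[of _ v]) auto
  next
    case False
    let ?X = "{h \<oplus>\<^bsub>M\<^esub> c \<odot>\<^bsub>M\<^esub> v | h c. h \<in> H \<and> c \<in> carrier K}"
    have X: "submodule ?X K M"
    proof (rule submodule_criterion)
      show "?X \<subseteq> carrier M" using v HM by auto
      show "\<zero>\<^bsub>M\<^esub> \<in> ?X" using H0 v by (intro CollectI exI[of _ "\<zero>\<^bsub>M\<^esub>"] exI[of _ "\<zero>\<^bsub>K\<^esub>"]) auto
    next
      fix a b assume "a \<in> ?X" "b \<in> ?X"
      then obtain h c h' c' where *: "a = h \<oplus>\<^bsub>M\<^esub> c \<odot>\<^bsub>M\<^esub> v" "b = h' \<oplus>\<^bsub>M\<^esub> c' \<odot>\<^bsub>M\<^esub> v"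
        "h \<in> H" "h' \<in> H" "c \<in> carrier K" "c' \<in> carrier K" by blast
      then have "a \<oplus>\<^bsub>M\<^esub> b = (h \<oplus>\<^bsub>M\<^esub> h') \<oplus>\<^bsub>M\<^esub> (c \<oplus>\<^bsub>K\<^esub> c') \<odot>\<^bsub>M\<^esub> v"
        using v HM by (simp add: smult_l_distr M.a_ac)
      then show "a \<oplus>\<^bsub>M\<^esub> b \<in> ?X" using * HE(5) by blast
    next
      fix d a assume d: "d \<in> carrier K" and "a \<in> ?X"
      then obtain h c where *: "a = h \<oplus>\<^bsub>M\<^esub> c \<odot>\<^bsub>M\<^esub> v" "h \<in> H" "c \<in> carrier K" by blast
      then have "d \<odot>\<^bsub>M\<^esub> a = d \<odot>\<^bsub>M\<^esub> h \<oplus>\<^bsub>M\<^esub> (d \<otimes>\<^bsub>K\<^esub> c) \<odot>\<^bsub>M\<^esub> v"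
        using v d HM by (simp add: smult_r_distr smult_assoc1)
      then show "d \<odot>\<^bsub>M\<^esub> a \<in> ?X" using * d HE(4) by blast
    qed
    have in_X: "h \<in> ?X" if "h \<in> H" for h
      using that v HM by (intro CollectI exI[of _ h] exI[of _ "\<zero>\<^bsub>K\<^esub>"]) auto
    have HX: "H \<subseteq> ?X" by (rule subsetI) (rule in_X)
    have vX: "v \<in> ?X" using H0 v by (intro CollectI exI[of _ "\<zero>\<^bsub>M\<^esub>"] exI[of _ "\<one>\<^bsub>K\<^esub>"]) auto
    have "x \<in> ?X"
    proof (rule ccontr)
      assume "x \<notin> ?X"
      with X HX have "?X = H" by (rule max)
      from vX[unfolded this] False show False by simp
    qed
    then obtain h c where hc: "x = h \<oplus>\<^bsub>M\<^esub> c \<odot>\<^bsub>M\<^esub> v" "h \<in> H" "c \<in> carrier K" by blast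
    then have c0: "c \<noteq> \<zero>\<^bsub>K\<^esub>" using H(3) v HM by auto
    then have ci: "inv\<^bsub>K\<^esub> c \<in> carrier K" "inv\<^bsub>K\<^esub> c \<otimes>\<^bsub>K\<^esub> c = \<one>\<^bsub>K\<^esub>"
      using hc(3) K.field_Units by auto
    have "c \<odot>\<^bsub>M\<^esub> v = \<ominus>\<^bsub>M\<^esub> h \<oplus>\<^bsub>M\<^esub> x"
      using hc v HM by (simp add: M.r_neg1)
    then have "inv\<^bsub>K\<^esub> c \<odot>\<^bsub>M\<^esub> (c \<odot>\<^bsub>M\<^esub> v) = inv\<^bsub>K\<^esub> c \<odot>\<^bsub>M\<^esub> (\<ominus>\<^bsub>M\<^esub> h) \<oplus>\<^bsub>M\<^esub> inv\<^bsub>K\<^esub> c \<odot>\<^bsub>M\<^esub> x"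
      using ci(1) hc(2) HM x by (simp add: smult_r_distr)
    then have "v = inv\<^bsub>K\<^esub> c \<odot>\<^bsub>M\<^esub> (\<ominus>\<^bsub>M\<^esub> h) \<oplus>\<^bsub>M\<^esub> inv\<^bsub>K\<^esub> c \<odot>\<^bsub>M\<^esub> x"
      using ci hc(3) v by (simp add: smult_assoc1[symmetric])
    then show ?thesis using ci(1) hc(2) HE(3,4) by blast
  qed
  have uniq: "c = c'"
    if "c \<in> carrier K" "c' \<in> carrier K" "h \<in> H" "h' \<in> H" "h \<oplus>\<^bsub>M\<^esub> c \<odot>\<^bsub>M\<^esub> x = h' \<oplus>\<^bsub>M\<^esub> c' \<odot>\<^bsub>M\<^esub> x" for c c' h h'
  proof (rule ccontr)
    assume "c \<noteq> c'"
    let ?d = "c \<oplus>\<^bsub>K\<^esub> \<ominus>\<^bsub>K\<^esub> c'"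
    have "?d \<noteq> \<zero>\<^bsub>K\<^esub>" using \<open>c \<noteq> c'\<close> that(1,2) K.minus_equality[of c "\<ominus>\<^bsub>K\<^esub> c'"] by auto
    then have di: "inv\<^bsub>K\<^esub> ?d \<in> carrier K" "inv\<^bsub>K\<^esub> ?d \<otimes>\<^bsub>K\<^esub> ?d = \<one>\<^bsub>K\<^esub>"
      using that K.field_Units by auto
    have "c \<odot>\<^bsub>M\<^esub> x = \<ominus>\<^bsub>M\<^esub> h \<oplus>\<^bsub>M\<^esub> (h' \<oplus>\<^bsub>M\<^esub> c' \<odot>\<^bsub>M\<^esub> x)"
      using that x HM by (simp add: that(5)[symmetric] M.r_neg1)
    then have "?d \<odot>\<^bsub>M\<^esub> x = \<ominus>\<^bsub>M\<^esub> h \<oplus>\<^bsub>M\<^esub> (h' \<oplus>\<^bsub>M\<^esub> c' \<odot>\<^bsub>M\<^esub> x) \<oplus>\<^bsub>M\<^esub> \<ominus>\<^bsub>M\<^esub> (c' \<odot>\<^bsub>M\<^esub> x)"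
      using that x by (simp add: smult_l_distr smult_l_minus)
    also have "\<dots> = \<ominus>\<^bsub>M\<^esub> h \<oplus>\<^bsub>M\<^esub> h'"
      using that x HM by (simp add: M.a_assoc M.r_neg)
    finally have "?d \<odot>\<^bsub>M\<^esub> x \<in> H" using that HE(3,5) by simp
    then have "inv\<^bsub>K\<^esub> ?d \<odot>\<^bsub>M\<^esub> (?d \<odot>\<^bsub>M\<^esub> x) \<in> H" using HE(4) di by blast
    then show False using H(3) di that x by (simp add: smult_assoc1[symmetric])
  qed
  define \<phi> where "\<phi> v = (THE c. c \<in> carrier K \<and> (\<exists>h\<in>H. v = h \<oplus>\<^bsub>M\<^esub> c \<odot>\<^bsub>M\<^esub> x))" for v
  have \<phi>: "\<phi> v = c" if "c \<in> carrier K" "h \<in> H" "v = h \<oplus>\<^bsub>M\<^esub> c \<odot>\<^bsub>M\<^esub> x" for v c h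
    unfolding \<phi>_def by (rule the_equality) (use that uniq in blast)+
  show thesis
  proof (rule that)
    show "\<phi> \<in> linear_maps K M (scalars K)"
    proof (rule linear_mapsI)
      show "\<phi> v \<in> carrier (scalars K)" if "v \<in> carrier M" for v
        using ex[OF that] \<phi> by auto
      fix v w assume "v \<in> carrier M" "w \<in> carrier M"
      then obtain h c h' c' where *: "v = h \<oplus>\<^bsub>M\<^esub> c \<odot>\<^bsub>M\<^esub> x" "w = h' \<oplus>\<^bsub>M\<^esub> c' \<odot>\<^bsub>M\<^esub> x"
        "h \<in> H" "h' \<in> H" "c \<in> carrier K" "c' \<in> carrier K" using ex by metis
      then have "v \<oplus>\<^bsub>M\<^esub> w = (h \<oplus>\<^bsub>M\<^esub> h') \<oplus>\<^bsub>M\<^esub> (c \<oplus>\<^bsub>K\<^esub> c') \<odot>\<^bsub>M\<^esub> x"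
        using x HM by (simp add: smult_l_distr M.a_ac)
      then have "\<phi> (v \<oplus>\<^bsub>M\<^esub> w) = c \<oplus>\<^bsub>K\<^esub> c'" using * HE(5) by (intro \<phi>) auto
      then show "\<phi> (v \<oplus>\<^bsub>M\<^esub> w) = \<phi> v \<oplus>\<^bsub>scalars K\<^esub> \<phi> w"
        using \<phi>[OF *(5,3,1)] \<phi>[OF *(6,4,2)] by simp
    next
      fix d v assume d: "d \<in> carrier K" and "v \<in> carrier M"
      then obtain h c where *: "v = h \<oplus>\<^bsub>M\<^esub> c \<odot>\<^bsub>M\<^esub> x" "h \<in> H" "c \<in> carrier K" using ex by metis
      then have "d \<odot>\<^bsub>M\<^esub> v = d \<odot>\<^bsub>M\<^esub> h \<oplus>\<^bsub>M\<^esub> (d \<otimes>\<^bsub>K\<^esub> c) \<odot>\<^bsub>M\<^esub> x"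
        using x d HM by (simp add: smult_r_distr smult_assoc1)
      then have "\<phi> (d \<odot>\<^bsub>M\<^esub> v) = d \<otimes>\<^bsub>K\<^esub> c" using * d HE(4) by (intro \<phi>) auto
      then show "\<phi> (d \<odot>\<^bsub>M\<^esub> v) = d \<odot>\<^bsub>scalars K\<^esub> \<phi> v"
        using \<phi>[OF *(3,2,1)] by simp
    qed
    show "\<phi> x = \<one>\<^bsub>K\<^esub>" by (rule \<phi>[OF _ H0]) (use x in auto)
    show "\<phi> v = \<zero>\<^bsub>K\<^esub>" if "v \<in> N" for v
      by (rule \<phi>[of _ v]) (use that H(2) HM x in auto)
  qed
qed

lemma submodule_image:
  assumes "module K M" "module K N" and f: "f \<in> linear_maps K M N" and H: "submodule H K M"
  shows "submodule (f ` H) K N"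
proof -
  interpret M: module K M by fact
  interpret N: module K N by fact
  note HE = M.submoduleE[OF H]
  note fD = linear_mapsD[OF f]
  have HM: "h \<in> carrier M" if "h \<in> H" for h using that HE(1) by blast
  have "\<zero>\<^bsub>M\<^esub> \<in> H" using subgroup.one_closed[OF submodule.axioms(1)[OF H]] by simp
  then have "\<zero>\<^bsub>N\<^esub> \<in> f ` H" using linear_maps_zero[OF assms(1-3)] by (metis imageI)
  moreover have "u \<oplus>\<^bsub>N\<^esub> v \<in> f ` H" if uv: "u \<in> f ` H" "v \<in> f ` H" for u v
  proof -
    obtain a b where "u = f a" "v = f b" "a \<in> H" "b \<in> H" using uv by blast
    then show ?thesis using HE(5) by (auto simp: HM fD(2)[symmetric])
  qed
  moreover have "c \<odot>\<^bsub>N\<^esub> v \<in> f ` H" if c: "c \<in> carrier K" and v: "v \<in> f ` H" for c v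
  proof -
    obtain b where "v = f b" "b \<in> H" using v by blast
    then show ?thesis using HE(4) c by (auto simp: HM fD(3)[symmetric])
  qed
  ultimately show ?thesis
    using HM fD(1) by (intro N.submodule_criterion) auto
qed

lemma submodule_kernel:
  assumes "module K M" "module K N" and f: "f \<in> linear_maps K M N"
  shows "submodule {x \<in> carrier M. f x = \<zero>\<^bsub>N\<^esub>} K M"
proof -
  interpret M: module K M by fact
  interpret N: module K N by fact
  show ?thesis
    by (rule M.submodule_criterion)
       (auto simp: linear_mapsD[OF f] linear_maps_zero[OF assms])
qed

section \<open>Idempotent endomorphisms\<close>

definition seq_sub :: "('k, 'v) seq \<Rightarrow> (int \<Rightarrow> 'v set) \<Rightarrow> ('k, 'v) seq" where
  "seq_sub V S = V\<lparr>seq_space := (\<lambda>i. (seq_space V i)\<lparr>carrier := S i\<rparr>)\<rparr>"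

lemma seq_sub_simps [simp]:
  "seq_space (seq_sub V S) i = (seq_space V i)\<lparr>carrier := S i\<rparr>"
  "seq_diff (seq_sub V S) = seq_diff V"
  by (simp_all add: seq_sub_def)

lemma seq_object_sub:
  assumes V: "seq_object K V" and S: "\<And>i. submodule (S i) K (seq_space V i)"
    and d: "\<And>i x. x \<in> S i \<Longrightarrow> seq_diff V i x \<in> S (i + 1)"
  shows "seq_object K (seq_sub V S)"
proof -
  note M = seq_objectD(1)[OF V]
  have S_sub: "x \<in> S i \<Longrightarrow> x \<in> carrier (seq_space V i)" for x i
    using module.submoduleE(1)[OF M S] by blast
  have "module K (seq_space (seq_sub V S) i)" for i
    using submodule.submodule_is_module[OF S M] by simp
  moreover have "seq_diff V i \<in> linear_maps K (seq_space (seq_sub V S) i) (seq_space (seq_sub V S) (i + 1))" for i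
    using linear_mapsD[OF seq_objectD(2)[OF V]] by (intro linear_mapsI) (auto simp: d S_sub)
  ultimately show ?thesis by (simp add: seq_object_def)
qed

lemma carrier_binary_coproduct:
  assumes "seq_object K W1" "seq_object K W2"
  shows "carrier (seq_space (seq_coproduct UNIV (\<lambda>b::bool. if b then W1 else W2)) i) =
    {x. x True \<in> carrier (seq_space W1 i) \<and> x False \<in> carrier (seq_space W2 i)}"
proof -
  have M: "module K (seq_space (if b then W1 else W2) i)" for b :: bool
    using assms by (simp add: seq_objectD(1))
  show ?thesis
    unfolding seq_coproduct_def seq.simps carrier_direct_sum[of UNIV K, OF M]
    by (auto simp: PiE_iff all_bool_eq)
qed

text \<open>
  Idempotent endomorphisms \<open>e\<close> and decompositions into two summands correspond to each other: \<open>e\<close>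
  splits \<open>V\<close> into its image and its kernel, and a decomposition yields the projection onto its first
  summand. The image is zero iff \<open>e\<close> is zero, and the kernel is zero iff \<open>e\<close> is the identity.
\<close>

lemma indecomposable_iff_idempotents_trivial:
  fixes V :: "('k, 'v) seq"
  assumes V: "seq_object K V"
  shows "indecomposable K V \<longleftrightarrow> \<not> seq_zero V \<and>
    (\<forall>e\<in>seq_morphisms K V V. (\<forall>i. \<forall>x\<in>carrier (seq_space V i). e i (e i x) = e i x) \<longrightarrow>
      (\<forall>i. \<forall>x\<in>carrier (seq_space V i). e i x = \<zero>\<^bsub>seq_space V i\<^esub>) \<or>
      (\<forall>i. \<forall>x\<in>carrier (seq_space V i). e i x = x))"
    (is "_ \<longleftrightarrow> _ \<and> (\<forall>e\<in>_. ?idem e \<longrightarrow> ?zero e \<or> ?one e)")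
proof (intro iffI conjI ballI impI)
  assume "indecomposable K V"
  then show "\<not> seq_zero V" by (simp add: indecomposable_def)
next
  fix e assume ind: "indecomposable K V" and e: "e \<in> seq_morphisms K V V" and idem: "?idem e"
  note M = seq_objectD(1)[OF V]
  note dD = linear_mapsD[OF seq_objectD(2)[OF V]]
  note el = seq_morphismsD(1)[OF e]
  note eD = linear_mapsD[OF el]
  note ed = seq_morphismsD(3)[OF e]
  have dz: "seq_diff V i \<zero>\<^bsub>seq_space V i\<^esub> = \<zero>\<^bsub>seq_space V (i + 1)\<^esub>" for i
    by (rule linear_maps_zero[OF M M seq_objectD(2)[OF V]])
  define W1 where "W1 = seq_sub V (\<lambda>i. e i ` carrier (seq_space V i))"
  define W2 where "W2 = seq_sub V (\<lambda>i. {x \<in> carrier (seq_space V i). e i x = \<zero>\<^bsub>seq_space V i\<^esub>})"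
  let ?W = "seq_coproduct UNIV (\<lambda>b::bool. if b then W1 else W2)"
  have W1: "seq_object K W1" unfolding W1_def
    by (rule seq_object_sub[OF V submodule_image[OF M M el module.carrier_is_submodule[OF M]]])
       (auto simp: ed[symmetric] dD(1))
  have W2: "seq_object K W2" unfolding W2_def
    by (rule seq_object_sub[OF V submodule_kernel[OF M M el]]) (auto simp: ed dD(1) dz)
  have C: "carrier (seq_space ?W i) = {x. x True \<in> e i ` carrier (seq_space V i) \<and>
      x False \<in> carrier (seq_space V i) \<and> e i (x False) = \<zero>\<^bsub>seq_space V i\<^esub>}" for i
    unfolding carrier_binary_coproduct[OF W1 W2] by (auto simp: W1_def W2_def)
  have ops: "x \<oplus>\<^bsub>seq_space ?W i\<^esub> y = (\<lambda>b. x b \<oplus>\<^bsub>seq_space V i\<^esub> y b)"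
    "c \<odot>\<^bsub>seq_space ?W i\<^esub> x = (\<lambda>b. c \<odot>\<^bsub>seq_space V i\<^esub> x b)"
    "seq_diff ?W i x = (\<lambda>b. seq_diff V i (x b))" for i c x y
    by (auto simp: fun_eq_iff seq_coproduct_def W1_def W2_def)
  have CV: "x b \<in> carrier (seq_space V i)" if "x \<in> carrier (seq_space ?W i)" for i b x
    using that eD(1) by (cases b) (auto simp: C)
  define f where "f i v = (\<lambda>b. if b then e i v else v \<ominus>\<^bsub>seq_space V i\<^esub> e i v)" for i v
  define g where "g i w = w True \<oplus>\<^bsub>seq_space V i\<^esub> w False" for i and w :: "bool \<Rightarrow> 'v"
  have em: "e i (\<ominus>\<^bsub>seq_space V i\<^esub> v) = \<ominus>\<^bsub>seq_space V i\<^esub> e i v" if "v \<in> carrier (seq_space V i)" for i v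
  proof -
    interpret module K "seq_space V i" by (rule M)
    show ?thesis using that eD(3)[of "\<ominus>\<^bsub>K\<^esub> \<one>\<^bsub>K\<^esub>" v i] by (simp add: smult_l_minus eD(1))
  qed
  have dm: "seq_diff V i (\<ominus>\<^bsub>seq_space V i\<^esub> v) = \<ominus>\<^bsub>seq_space V (i + 1)\<^esub> seq_diff V i v"
    if "v \<in> carrier (seq_space V i)" for i v
  proof -
    interpret module K "seq_space V i" by (rule M)
    interpret M': module K "seq_space V (i + 1)" by (rule M)
    show ?thesis using that dD(3)[of "\<ominus>\<^bsub>K\<^esub> \<one>\<^bsub>K\<^esub>" v i] by (simp add: smult_l_minus M'.smult_l_minus dD(1))
  qed
  have f: "f \<in> seq_morphisms K V ?W"
    unfolding seq_morphisms_def
  proof (intro CollectI conjI allI ballI)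
    fix i
    interpret module K "seq_space V i" by (rule M)
    show "f i \<in> linear_maps K (seq_space V i) (seq_space ?W i)"
    proof (rule linear_mapsI)
      fix x assume "x \<in> carrier (seq_space V i)"
      then show "f i x \<in> carrier (seq_space ?W i)"
        using idem by (auto simp: C f_def M.minus_eq eD em M.r_neg)
    next
      fix x y assume "x \<in> carrier (seq_space V i)" "y \<in> carrier (seq_space V i)"
      then show "f i (x \<oplus>\<^bsub>seq_space V i\<^esub> y) = f i x \<oplus>\<^bsub>seq_space ?W i\<^esub> f i y"
        by (auto simp: fun_eq_iff f_def ops eD M.minus_eq M.minus_add M.a_ac)
    next
      fix c x assume "c \<in> carrier K" "x \<in> carrier (seq_space V i)"
      then show "f i (c \<odot>\<^bsub>seq_space V i\<^esub> x) = c \<odot>\<^bsub>seq_space ?W i\<^esub> f i x"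
        by (auto simp: fun_eq_iff f_def ops eD M.minus_eq smult_r_distr smult_r_minus)
    qed
    fix x assume "x \<in> carrier (seq_space V i)"
    then show "f (i + 1) (seq_diff V i x) = seq_diff ?W i (f i x)"
      using module.axioms(2)[OF M[of "i + 1"]]
      by (auto simp: fun_eq_iff f_def ops eD dD dm ed M.minus_eq a_minus_def)
  qed
  have g: "g \<in> seq_morphisms K ?W V"
    unfolding seq_morphisms_def
  proof (intro CollectI conjI allI ballI)
    fix i
    interpret module K "seq_space V i" by (rule M)
    show "g i \<in> linear_maps K (seq_space ?W i) (seq_space V i)"
      by (rule linear_mapsI)
         (auto simp: CV g_def ops M.a_ac smult_r_distr)
    fix x assume "x \<in> carrier (seq_space ?W i)"
    then show "g (i + 1) (seq_diff ?W i x) = seq_diff V i (g i x)"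
      by (auto simp: CV g_def ops dD)
  qed
  have "seq_iso K V ?W"
    unfolding seq_iso_def
  proof (intro bexI[OF _ f] bexI[OF _ g] conjI allI ballI)
    fix i
    interpret module K "seq_space V i" by (rule M)
    fix x assume "x \<in> carrier (seq_space V i)"
    then show "g i (f i x) = x"
      by (simp add: f_def g_def M.minus_eq eD M.a_lcomm[of "e i x" x] M.r_neg)
  next
    fix i
    interpret module K "seq_space V i" by (rule M)
    fix y assume y: "y \<in> carrier (seq_space ?W i)"
    then obtain u where u: "u \<in> carrier (seq_space V i)" "y True = e i u"
      and y0: "y False \<in> carrier (seq_space V i)" "e i (y False) = \<zero>\<^bsub>seq_space V i\<^esub>" by (auto simp: C)
    have "e i (y True \<oplus>\<^bsub>seq_space V i\<^esub> y False) = y True"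
      using u y0 idem by (simp add: eD)
    then show "f i (g i y) = y"
      using u y0 by (auto simp: fun_eq_iff f_def g_def M.minus_eq eD M.a_ac M.r_neg1 M.r_neg2 M.r_neg)
  qed
  then have "seq_zero W1 \<or> seq_zero W2"
    using ind W1 W2 unfolding indecomposable_def by blast
  then show "?zero e \<or> ?one e"
  proof
    assume "seq_zero W1"
    then have "e i ` carrier (seq_space V i) = {\<zero>\<^bsub>seq_space V i\<^esub>}" for i
      by (simp add: seq_zero_def W1_def)
    then show ?thesis by blast
  next
    assume "seq_zero W2"
    then have z: "x = \<zero>\<^bsub>seq_space V i\<^esub>"
      if "x \<in> carrier (seq_space V i)" "e i x = \<zero>\<^bsub>seq_space V i\<^esub>" for i x
      using that by (auto simp: seq_zero_def W2_def)
    have "e i x = x" if x: "x \<in> carrier (seq_space V i)" for i x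
    proof -
      interpret module K "seq_space V i" by (rule M)
      have "e i (x \<ominus>\<^bsub>seq_space V i\<^esub> e i x) = \<zero>\<^bsub>seq_space V i\<^esub>"
        using x idem by (simp add: M.minus_eq eD em M.r_neg)
      then have "x \<ominus>\<^bsub>seq_space V i\<^esub> e i x = \<zero>\<^bsub>seq_space V i\<^esub>" by (rule z[rotated]) (use x eD(1) in auto)
      then show ?thesis
        using x eD(1)[OF x] M.minus_equality[of x "\<ominus>\<^bsub>seq_space V i\<^esub> e i x"] by (simp add: M.minus_eq)
    qed
    then show ?thesis by blast
  qed
next
  assume *: "\<not> seq_zero V \<and> (\<forall>e\<in>seq_morphisms K V V. ?idem e \<longrightarrow> ?zero e \<or> ?one e)"
  show "indecomposable K V"
    unfolding indecomposable_def
  proof (intro conjI notI)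
    assume "\<exists>W1 W2 :: ('k, 'v) seq. seq_object K W1 \<and> seq_object K W2 \<and>
      \<not> seq_zero W1 \<and> \<not> seq_zero W2 \<and> seq_iso K V (seq_coproduct UNIV (\<lambda>b::bool. if b then W1 else W2))"
    then obtain W1 W2 :: "('k, 'v) seq" where W: "seq_object K W1" "seq_object K W2"
      and nz: "\<not> seq_zero W1" "\<not> seq_zero W2"
      and iso: "seq_iso K V (seq_coproduct UNIV (\<lambda>b::bool. if b then W1 else W2))" by blast
    let ?U = "\<lambda>b::bool. if b then W1 else W2"
    let ?W = "seq_coproduct UNIV ?U"
    have U: "seq_object K (?U b)" for b using W by simp
    obtain f g where f: "f \<in> seq_morphisms K V ?W" and g: "g \<in> seq_morphisms K ?W V"
      and gf: "\<And>i x. x \<in> carrier (seq_space V i) \<Longrightarrow> g i (f i x) = x"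
      and fg: "\<And>i y. y \<in> carrier (seq_space ?W i) \<Longrightarrow> f i (g i y) = y"
      using iso unfolding seq_iso_def by blast
    have C: "carrier (seq_space ?W i) =
      {x. x True \<in> carrier (seq_space W1 i) \<and> x False \<in> carrier (seq_space W2 i)}" for i
      by (rule carrier_binary_coproduct[OF W])
    have ops: "x \<oplus>\<^bsub>seq_space ?W i\<^esub> y = (\<lambda>b. x b \<oplus>\<^bsub>seq_space (?U b) i\<^esub> y b)"
      "c \<odot>\<^bsub>seq_space ?W i\<^esub> x = (\<lambda>b. c \<odot>\<^bsub>seq_space (?U b) i\<^esub> x b)"
      "seq_diff ?W i x = (\<lambda>b. seq_diff (?U b) i (x b))" for i c x y
      by (simp_all add: seq_coproduct_def fun_eq_iff)
    define p where "p i x = (\<lambda>b. if b then x b else \<zero>\<^bsub>seq_space W2 i\<^esub>)" for i and x :: "bool \<Rightarrow> 'v"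
    have zc: "\<zero>\<^bsub>seq_space W1 i\<^esub> \<in> carrier (seq_space W1 i)" "\<zero>\<^bsub>seq_space W2 i\<^esub> \<in> carrier (seq_space W2 i)" for i
      using module_zero_closed seq_objectD(1) W by blast+
    have dz: "seq_diff W2 i \<zero>\<^bsub>seq_space W2 i\<^esub> = \<zero>\<^bsub>seq_space W2 (i + 1)\<^esub>" for i
      using linear_maps_zero seq_objectD W(2) by blast
    have p: "p \<in> seq_morphisms K ?W ?W"
      unfolding seq_morphisms_def
    proof (intro CollectI conjI allI ballI)
      fix i
      interpret W2: module K "seq_space W2 i" by (rule seq_objectD(1)[OF W(2)])
      show "p i \<in> linear_maps K (seq_space ?W i) (seq_space ?W i)"
        by (rule linear_mapsI) (auto simp: C zc fun_eq_iff p_def ops)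
      fix x assume "x \<in> carrier (seq_space ?W i)"
      then show "p (i + 1) (seq_diff ?W i x) = seq_diff ?W i (p i x)"
        by (auto simp: fun_eq_iff p_def ops dz)
    qed
    have pC: "p i y \<in> carrier (seq_space ?W i)" if "y \<in> carrier (seq_space ?W i)" for i y
      by (rule seq_morphismsD(2)[OF p that])
    have fC: "f i x \<in> carrier (seq_space ?W i)" if "x \<in> carrier (seq_space V i)" for i x
      by (rule seq_morphismsD(2)[OF f that])
    have gC: "g i x \<in> carrier (seq_space V i)" if "x \<in> carrier (seq_space ?W i)" for i x
      by (rule seq_morphismsD(2)[OF g that])
    define e where "e = (\<lambda>i x. g i (p i (f i x)))"
    have "e \<in> seq_morphisms K V V"
      unfolding e_def by (rule seq_morphisms_comp[OF seq_morphisms_comp[OF f p] g])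
    moreover have "p i (p i y) = p i y" for i y by (simp add: p_def fun_eq_iff)
    then have "?idem e"
      using fg pC fC by (simp add: e_def)
    moreover have eg: "e i (g i y) = g i (p i y)" if "y \<in> carrier (seq_space ?W i)" for i y
      using fg[OF that] by (simp add: e_def)
    have inj: "y = z" if "y \<in> carrier (seq_space ?W i)" "z \<in> carrier (seq_space ?W i)" "g i y = g i z" for i y z
      using fg that by metis
    ultimately have "?zero e \<or> ?one e" using * by blast
    then show False
    proof
      assume zero: "?zero e"
      have "y = \<zero>\<^bsub>seq_space W1 i\<^esub>" if y: "y \<in> carrier (seq_space W1 i)" for i y
      proof -
        let ?y = "\<lambda>b. if b then y else \<zero>\<^bsub>seq_space W2 i\<^esub>"
        let ?z = "\<lambda>b. if b then \<zero>\<^bsub>seq_space W1 i\<^esub> else \<zero>\<^bsub>seq_space W2 i\<^esub>"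
        have yC: "?y \<in> carrier (seq_space ?W i)" "?z \<in> carrier (seq_space ?W i)" using y zc by (auto simp: C)
        have "g i (p i ?y) = g i (p i ?z)"
          using eg[OF yC(1)] eg[OF yC(2)] zero gC[OF yC(1)] gC[OF yC(2)] by metis
        then have "p i ?y = p i ?z" using inj pC yC by blast
        then show ?thesis by (auto simp: p_def fun_eq_iff all_bool_eq)
      qed
      then show False using nz(1) zc unfolding seq_zero_def by blast
    next
      assume one: "?one e"
      have "y = \<zero>\<^bsub>seq_space W2 i\<^esub>" if y: "y \<in> carrier (seq_space W2 i)" for i y
      proof -
        let ?y = "\<lambda>b. if b then \<zero>\<^bsub>seq_space W1 i\<^esub> else y"
        have yC: "?y \<in> carrier (seq_space ?W i)" using y zc by (auto simp: C)
        have "g i (p i ?y) = g i ?y"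
          using eg[OF yC] one gC[OF yC] by metis
        then have "p i ?y = ?y" using inj pC yC by blast
        then show ?thesis by (auto simp: p_def fun_eq_iff all_bool_eq)
      qed
      then show False using nz(2) zc unfolding seq_zero_def by blast
    qed
  qed (use V * in auto)
qed

section \<open>Interval summands\<close>

text \<open>
  A chain of vectors together with a chain of functionals dual to it, over the degrees in \<open>A\<close>.
  When \<open>A\<close> is an interval and, moreover, the differential kills the last vector and the first
  functional kills what enters from the left, the vectors span an interval object and the
  functionals are a retraction onto it.
\<close>

definition dual_chain ::
  "('k, 'm) ring_scheme \<Rightarrow> ('k, 'v) seq \<Rightarrow> int set \<Rightarrow> (int \<Rightarrow> 'v) \<Rightarrow> (int \<Rightarrow> 'v \<Rightarrow> 'k) \<Rightarrow> bool" where
  "dual_chain K V A x \<phi> \<longleftrightarrow>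
     (\<forall>l\<in>A. x l \<in> carrier (seq_space V l) \<and> \<phi> l \<in> linear_maps K (seq_space V l) (scalars K) \<and> \<phi> l (x l) = \<one>\<^bsub>K\<^esub>) \<and>
     (\<forall>l. l \<in> A \<longrightarrow> l + 1 \<in> A \<longrightarrow> seq_diff V l (x l) = x (l + 1) \<and>
        (\<forall>v\<in>carrier (seq_space V l). \<phi> (l + 1) (seq_diff V l v) = \<phi> l v))"

text \<open>
  The image of \<open>V (i - n)\<close> in \<open>V i\<close>. Below, a vector is called infinitely deep if it lies in all
  these images; this alone does not give it an infinite chain of successive preimages.
\<close>

primrec iterated_image :: "('k, 'v) seq \<Rightarrow> nat \<Rightarrow> int \<Rightarrow> 'v set" where
  "iterated_image V 0 i = carrier (seq_space V i)"
| "iterated_image V (Suc n) i = seq_diff V (i - 1) ` iterated_image V n (i - 1)"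

lemma seq_diff_linear_pred:
  "seq_object K V \<Longrightarrow> seq_diff V (i - 1) \<in> linear_maps K (seq_space V (i - 1)) (seq_space V i)"
  using seq_objectD(2)[of K V "i - 1"] by simp

lemma submodule_iterated_image:
  assumes V: "seq_object K V" shows "submodule (iterated_image V n i) K (seq_space V i)"
proof (induction n arbitrary: i)
  case 0 show ?case using module.carrier_is_submodule[OF seq_objectD(1)[OF V]] by simp
next
  case (Suc n) show ?case
    using submodule_image[OF seq_objectD(1)[OF V] seq_objectD(1)[OF V] seq_diff_linear_pred[OF V] Suc.IH]
    by simp
qed

lemma iterated_image_subset_carrier:
  assumes V: "seq_object K V" shows "iterated_image V n i \<subseteq> carrier (seq_space V i)"
  by (rule module.submoduleE(1)[OF seq_objectD(1)[OF V] submodule_iterated_image[OF V]])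

text \<open>
  As \<open>f\<close> is injective, \<open>f x\<close> lies outside the image of the kernel of \<open>\<phi>\<close>. A functional \<open>\<psi>\<close> that
  separates the two agrees with \<open>\<phi>\<close> on the kernel of \<open>\<phi>\<close> and on \<open>x\<close>, and these span.
\<close>

lemma functional_extends_along_injection:
  assumes "field K" "module K M" "module K N" and f: "f \<in> linear_maps K M N" "inj_on f (carrier M)"
    and \<phi>: "\<phi> \<in> linear_maps K M (scalars K)" and x: "x \<in> carrier M" "\<phi> x = \<one>\<^bsub>K\<^esub>"
  obtains \<psi> where "\<psi> \<in> linear_maps K N (scalars K)" "\<And>v. v \<in> carrier M \<Longrightarrow> \<psi> (f v) = \<phi> v"
proof -
  interpret K: field K by fact
  interpret M: module K M by fact
  interpret N: module K N by fact
  note fD = linear_mapsD[OF f(1)] and \<phi>D = linear_mapsD[OF \<phi>, simplified]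
  let ?H = "{v \<in> carrier M. \<phi> v = \<zero>\<^bsub>K\<^esub>}"
  have sub: "submodule (f ` ?H) K N"
    using submodule_kernel[OF \<open>module K M\<close> module_scalars[OF K.is_cring] \<phi>]
    by (intro submodule_image[OF \<open>module K M\<close> \<open>module K N\<close> f(1)]) simp
  have fx: "f x \<notin> f ` ?H"
  proof
    assume "f x \<in> f ` ?H"
    then obtain v where v: "v \<in> carrier M" "\<phi> v = \<zero>\<^bsub>K\<^esub>" "f x = f v" by blast
    have "x = v" by (rule inj_onD[OF f(2) v(3) x(1) v(1)])
    then show False using v(2) x(2) by simp
  qed
  obtain \<psi> where \<psi>: "\<psi> \<in> linear_maps K N (scalars K)" "\<psi> (f x) = \<one>\<^bsub>K\<^esub>"
    and z: "\<And>v. v \<in> f ` ?H \<Longrightarrow> \<psi> v = \<zero>\<^bsub>K\<^esub>"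
    by (rule separating_functional[OF \<open>field K\<close> \<open>module K N\<close> sub fD(1)[OF x(1)] fx]) blast
  note \<psi>D = linear_mapsD[OF \<psi>(1), simplified]
  have add: "\<psi> (f (w \<oplus>\<^bsub>M\<^esub> c \<odot>\<^bsub>M\<^esub> x)) = \<psi> (f w) \<oplus>\<^bsub>K\<^esub> c \<otimes>\<^bsub>K\<^esub> \<psi> (f x)"
    if "w \<in> carrier M" "c \<in> carrier K" for w c
    using that x by (simp add: fD \<psi>D)
  show thesis
  proof (rule that[OF \<psi>(1)])
    fix v assume v: "v \<in> carrier M"
    let ?w = "v \<oplus>\<^bsub>M\<^esub> (\<ominus>\<^bsub>K\<^esub> \<phi> v) \<odot>\<^bsub>M\<^esub> x"
    have w: "?w \<in> ?H" using v x by (simp add: \<phi>D K.r_neg)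
    have "v = ?w \<oplus>\<^bsub>M\<^esub> \<phi> v \<odot>\<^bsub>M\<^esub> x"
      using v x by (simp add: \<phi>D M.a_assoc M.smult_l_distr[symmetric] K.l_neg)
    then have "\<psi> (f v) = \<psi> (f (?w \<oplus>\<^bsub>M\<^esub> \<phi> v \<odot>\<^bsub>M\<^esub> x))" by simp
    also have "\<dots> = \<psi> (f ?w) \<oplus>\<^bsub>K\<^esub> \<phi> v \<otimes>\<^bsub>K\<^esub> \<psi> (f x)"
      using v x by (intro add) (auto simp: \<phi>D)
    also have "\<dots> = \<phi> v" using z[of "f ?w"] w v \<psi>(2) by (simp add: \<phi>D)
    finally show "\<psi> (f v) = \<phi> v" .
  qed
qed

text \<open>
  To the right, the vectors are forced to be the images of \<open>x\<close>. Either the chain ends at once, or all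
  differentials are injective and the functional is extended along them one degree at a time.
\<close>

lemma dual_chain_rightwards:
  fixes K :: "('k, 'm) ring_scheme" and V :: "('k, 'v) seq"
  assumes "field K" and V: "seq_object K V"
    and x: "x \<in> carrier (seq_space V i)" and \<phi>: "\<phi> \<in> linear_maps K (seq_space V i) (scalars K)" "\<phi> x = \<one>\<^bsub>K\<^esub>"
    and end_or_inj: "seq_diff V i x = \<zero>\<^bsub>seq_space V (i + 1)\<^esub> \<or> (\<forall>l. inj_on (seq_diff V l) (carrier (seq_space V l)))"
  obtains b xs \<phi>s where "b \<noteq> -\<infinity>" "Fin i \<le> b" "dual_chain K V {l. i \<le> l \<and> Fin l \<le> b} xs \<phi>s"
    "xs i = x" "\<phi>s i = \<phi>" "\<And>l. Fin l = b \<Longrightarrow> seq_diff V l (xs l) = \<zero>\<^bsub>seq_space V (l + 1)\<^esub>"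
  using end_or_inj
proof
  assume "seq_diff V i x = \<zero>\<^bsub>seq_space V (i + 1)\<^esub>"
  then show thesis
    using x \<phi> by (intro that[of "Fin i" "\<lambda>_. x" "\<lambda>_. \<phi>"]) (auto simp: dual_chain_def)
next
  assume inj: "\<forall>l. inj_on (seq_diff V l) (carrier (seq_space V l))"
  \<comment> \<open>A pair consists of the vector and the functional in degree \<open>i + n\<close>.\<close>
  define P where "P n p \<longleftrightarrow> fst p \<in> carrier (seq_space V (i + int n)) \<and>
    snd p \<in> linear_maps K (seq_space V (i + int n)) (scalars K) \<and> snd p (fst p) = \<one>\<^bsub>K\<^esub> \<and> (n = 0 \<longrightarrow> p = (x, \<phi>))" for n p
  define Q where "Q n p q \<longleftrightarrow> fst q = seq_diff V (i + int n) (fst p) \<and>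
    (\<forall>v\<in>carrier (seq_space V (i + int n)). snd q (seq_diff V (i + int n) v) = snd p v)" for n and p q :: "'v \<times> ('v \<Rightarrow> 'k)"
  have "\<exists>F. \<forall>n. P n (F n) \<and> Q n (F n) (F (Suc n))"
  proof (rule dependent_nat_choice)
    show "\<exists>p. P 0 p" using x \<phi> by (auto simp: P_def)
    fix p n assume p: "P n p"
    let ?l = "i + int n"
    note d = seq_objectD(2)[OF V, of ?l]
    obtain \<psi> where \<psi>: "\<psi> \<in> linear_maps K (seq_space V (?l + 1)) (scalars K)"
      "\<And>v. v \<in> carrier (seq_space V ?l) \<Longrightarrow> \<psi> (seq_diff V ?l v) = snd p v"
      using functional_extends_along_injection[OF \<open>field K\<close> seq_objectD(1)[OF V] seq_objectD(1)[OF V] d, of "snd p" "fst p"]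
        p inj unfolding P_def by blast
    have "P (Suc n) (seq_diff V ?l (fst p), \<psi>) \<and> Q n p (seq_diff V ?l (fst p), \<psi>)"
      using p \<psi> linear_mapsD(1)[OF d] by (auto simp: P_def Q_def ac_simps)
    then show "\<exists>q. P (Suc n) q \<and> Q n p q" by blast
  qed
  then obtain F where F: "\<And>n. P n (F n)" "\<And>n. Q n (F n) (F (Suc n))" by blast
  show thesis
  proof (rule that[of \<infinity> "\<lambda>l. fst (F (nat (l - i)))" "\<lambda>l. snd (F (nat (l - i)))"])
    have "fst (F (nat (l - i))) \<in> carrier (seq_space V l) \<and>
      snd (F (nat (l - i))) \<in> linear_maps K (seq_space V l) (scalars K) \<and>
      snd (F (nat (l - i))) (fst (F (nat (l - i)))) = \<one>\<^bsub>K\<^esub>" if "i \<le> l" for l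
      using F(1)[of "nat (l - i)"] that by (simp add: P_def)
    moreover have "nat (l + 1 - i) = Suc (nat (l - i))" if "i \<le> l" for l using that by simp
    then have "Q (nat (l - i)) (F (nat (l - i))) (F (nat (l + 1 - i)))" if "i \<le> l" for l
      using F(2)[of "nat (l - i)"] that by simp
    ultimately show "dual_chain K V {l. i \<le> l \<and> Fin l \<le> \<infinity>} (\<lambda>l. fst (F (nat (l - i)))) (\<lambda>l. snd (F (nat (l - i))))"
      by (auto simp: dual_chain_def Q_def)
  qed (use F(1)[of 0] in \<open>auto simp: P_def\<close>)
qed

text \<open>
  To the left, the functionals are forced to be the pullbacks of \<open>\<phi>\<close>. If \<open>x\<close> has a preimage \<open>n\<close> steps
  to the left and \<open>\<phi>\<close> vanishes on everything coming from one step further, then the chain can stop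
  there: the pullback of \<open>\<phi>\<close> kills what enters from the left.
\<close>

lemma dual_chain_leftwards_finite:
  assumes V: "seq_object K V"
  shows "\<lbrakk>x \<in> iterated_image V n i; \<phi> \<in> linear_maps K (seq_space V i) (scalars K); \<phi> x = \<one>\<^bsub>K\<^esub>;
     \<And>v. v \<in> iterated_image V (Suc n) i \<Longrightarrow> \<phi> v = \<zero>\<^bsub>K\<^esub>\<rbrakk> \<Longrightarrow>
    \<exists>xs \<phi>s. dual_chain K V {i - int n..i} xs \<phi>s \<and> xs i = x \<and> \<phi>s i = \<phi> \<and>
      (\<forall>v\<in>carrier (seq_space V (i - int n - 1)). \<phi>s (i - int n) (seq_diff V (i - int n - 1) v) = \<zero>\<^bsub>K\<^esub>)"
proof (induction n arbitrary: i x \<phi>)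
  case 0
  then show ?case
    by (intro exI[of _ "\<lambda>_. x"] exI[of _ "\<lambda>_. \<phi>"]) (auto simp: dual_chain_def)
next
  case (Suc n)
  note d = seq_diff_linear_pred[OF V, of i]
  obtain y where y: "y \<in> iterated_image V n (i - 1)" "x = seq_diff V (i - 1) y" using Suc.prems(1) by auto
  define \<psi> where "\<psi> = (\<lambda>v. \<phi> (seq_diff V (i - 1) v))"
  have "\<psi> \<in> linear_maps K (seq_space V (i - 1)) (scalars K)"
    unfolding \<psi>_def by (rule linear_maps_comp[OF d Suc.prems(2)])
  moreover have "\<psi> y = \<one>\<^bsub>K\<^esub>" using y Suc.prems(3) by (simp add: \<psi>_def)
  moreover have "\<psi> v = \<zero>\<^bsub>K\<^esub>" if "v \<in> iterated_image V (Suc n) (i - 1)" for v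
    using Suc.prems(4)[of "seq_diff V (i - 1) v"] that unfolding \<psi>_def iterated_image.simps(2)[of V "Suc n"] by blast
  ultimately obtain xs \<phi>s where IH: "dual_chain K V {i - 1 - int n..i - 1} xs \<phi>s" "xs (i - 1) = y" "\<phi>s (i - 1) = \<psi>"
    "\<forall>v\<in>carrier (seq_space V (i - 1 - int n - 1)). \<phi>s (i - 1 - int n) (seq_diff V (i - 1 - int n - 1) v) = \<zero>\<^bsub>K\<^esub>"
    using Suc.IH[OF y(1)] by metis
  have e: "i - int (Suc n) = i - 1 - int n" by simp
  have xc: "x \<in> carrier (seq_space V i)" using Suc.prems(1) iterated_image_subset_carrier[OF V] by blast
  have "dual_chain K V {i - 1 - int n..i} (xs(i := x)) (\<phi>s(i := \<phi>))"
    unfolding dual_chain_def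
  proof (intro conjI ballI allI impI)
    fix l assume l: "l \<in> {i - 1 - int n..i}"
    have "l = i \<or> l \<in> {i - 1 - int n..i - 1}" using l by auto
    then show "(xs(i := x)) l \<in> carrier (seq_space V l)"
      "(\<phi>s(i := \<phi>)) l \<in> linear_maps K (seq_space V l) (scalars K)"
      "(\<phi>s(i := \<phi>)) l ((xs(i := x)) l) = \<one>\<^bsub>K\<^esub>"
      using IH(1) xc Suc.prems(2,3) by (auto simp: dual_chain_def)
  next
    fix l assume l: "l \<in> {i - 1 - int n..i}" "l + 1 \<in> {i - 1 - int n..i}"
    have c: "l = i - 1 \<or> l \<noteq> i - 1 \<and> l \<in> {i - 1 - int n..i - 1} \<and> l + 1 \<in> {i - 1 - int n..i - 1}" using l by auto
    then show "seq_diff V l ((xs(i := x)) l) = (xs(i := x)) (l + 1)"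
      using IH(1,2) y(2) by (auto simp: dual_chain_def)
    fix v assume "v \<in> carrier (seq_space V l)"
    then show "(\<phi>s(i := \<phi>)) (l + 1) (seq_diff V l v) = (\<phi>s(i := \<phi>)) l v"
      using c IH(1,3) by (auto simp: dual_chain_def \<psi>_def)
  qed
  then show ?case unfolding e using IH(4)
    by (intro exI[of _ "xs(i := x)"] exI[of _ "\<phi>s(i := \<phi>)"] conjI) (assumption | simp)+
qed

lemma dual_chain_leftwards_infinite:
  fixes K :: "('k, 'm) ring_scheme" and V :: "('k, 'v) seq"
  assumes V: "seq_object K V"
    and lift: "\<And>l x. x \<in> (\<Inter>n. iterated_image V n l) \<Longrightarrow> \<exists>y\<in>\<Inter>n. iterated_image V n (l - 1). seq_diff V (l - 1) y = x"
    and x: "x \<in> (\<Inter>n. iterated_image V n i)"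
    and \<phi>: "\<phi> \<in> linear_maps K (seq_space V i) (scalars K)" "\<phi> x = \<one>\<^bsub>K\<^esub>"
  shows "\<exists>xs \<phi>s. dual_chain K V {..i} xs \<phi>s \<and> xs i = x \<and> \<phi>s i = \<phi>"
proof -
  define P where "P n p \<longleftrightarrow> fst p \<in> (\<Inter>m. iterated_image V m (i - int n)) \<and>
    snd p \<in> linear_maps K (seq_space V (i - int n)) (scalars K) \<and> snd p (fst p) = \<one>\<^bsub>K\<^esub> \<and> (n = 0 \<longrightarrow> p = (x, \<phi>))" for n p
  define Q where "Q n p q \<longleftrightarrow> fst p = seq_diff V (i - int n - 1) (fst q) \<and>
    snd q = (\<lambda>v. snd p (seq_diff V (i - int n - 1) v))" for n and p q :: "'v \<times> ('v \<Rightarrow> 'k)"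
  have "\<exists>F. \<forall>n. P n (F n) \<and> Q n (F n) (F (Suc n))"
  proof (rule dependent_nat_choice)
    show "\<exists>p. P 0 p" using x \<phi> by (auto simp: P_def)
    fix p n assume p: "P n p"
    let ?l = "i - int n"
    obtain y where y: "y \<in> (\<Inter>m. iterated_image V m (?l - 1))" "seq_diff V (?l - 1) y = fst p"
      using lift[of "fst p" ?l] p unfolding P_def by blast
    let ?q = "(y, \<lambda>v. snd p (seq_diff V (?l - 1) v))"
    have "snd ?q \<in> linear_maps K (seq_space V (?l - 1)) (scalars K)"
      using linear_maps_comp[OF seq_diff_linear_pred[OF V]] p by (auto simp: P_def)
    moreover have e: "i - int (Suc n) = ?l - 1" by simp
    ultimately have "P (Suc n) ?q \<and> Q n p ?q"
      unfolding P_def Q_def e using y p by (simp add: P_def)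
    then show "\<exists>q. P (Suc n) q \<and> Q n p q" by blast
  qed
  then obtain F where F: "\<And>n. P n (F n)" "\<And>n. Q n (F n) (F (Suc n))" by blast
  define xs where "xs l = fst (F (nat (i - l)))" for l
  define \<phi>s where "\<phi>s l = snd (F (nat (i - l)))" for l
  have 1: "(\<forall>m. xs l \<in> iterated_image V m l) \<and> \<phi>s l \<in> linear_maps K (seq_space V l) (scalars K) \<and> \<phi>s l (xs l) = \<one>\<^bsub>K\<^esub>" if "l \<le> i" for l
    using F(1)[of "nat (i - l)"] that unfolding P_def xs_def \<phi>s_def by auto
  have 2: "seq_diff V l (xs l) = xs (l + 1) \<and> \<phi>s l = (\<lambda>v. \<phi>s (l + 1) (seq_diff V l v))" if "l + 1 \<le> i" for l
  proof -
    have "Suc (nat (i - (l + 1))) = nat (i - l)" "i - int (nat (i - (l + 1))) - 1 = l" using that by auto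
    then show ?thesis using F(2)[of "nat (i - (l + 1))"] by (simp add: Q_def xs_def \<phi>s_def)
  qed
  have "xs l \<in> carrier (seq_space V l)" if "l \<le> i" for l
    using 1[OF that] iterated_image_subset_carrier[OF V, of 0 l] by blast
  then have "dual_chain K V {..i} xs \<phi>s"
    using 1 2 by (auto simp: dual_chain_def)
  moreover have "xs i = x" "\<phi>s i = \<phi>" using F(1)[of 0] by (auto simp: P_def xs_def \<phi>s_def)
  ultimately show ?thesis by blast
qed

text \<open>
  If all kernels consist of infinitely deep vectors, then every preimage \<open>y\<close> of an infinitely deep \<open>x\<close>
  is itself infinitely deep: for each \<open>n\<close> the vector \<open>x\<close> also has a preimage \<open>z\<close> in the \<open>n\<close>-th iterated
  image, and \<open>y\<close> differs from \<open>z\<close> by a kernel vector. So successive preimages can be chosen forever,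
  without any finiteness of dimension.
\<close>

lemma lift_of_infinitely_deep:
  assumes V: "seq_object K V"
    and ker: "\<And>l v. \<lbrakk>v \<in> carrier (seq_space V l); seq_diff V l v = \<zero>\<^bsub>seq_space V (l + 1)\<^esub>\<rbrakk> \<Longrightarrow> v \<in> (\<Inter>n. iterated_image V n l)"
    and x: "x \<in> (\<Inter>n. iterated_image V n l)"
  shows "\<exists>y\<in>\<Inter>n. iterated_image V n (l - 1). seq_diff V (l - 1) y = x"
proof -
  interpret M: module K "seq_space V (l - 1)" by (rule seq_objectD(1)[OF V])
  interpret N: module K "seq_space V l" by (rule seq_objectD(1)[OF V])
  note dD = linear_mapsD[OF seq_diff_linear_pred[OF V, of l]]
  have "x \<in> iterated_image V (Suc 0) l" using x by blast
  then obtain y where y: "y \<in> carrier (seq_space V (l - 1))" "seq_diff V (l - 1) y = x" by auto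
  have "y \<in> iterated_image V n (l - 1)" for n
  proof -
    have "x \<in> iterated_image V (Suc n) l" using x by blast
    then obtain z where z: "z \<in> iterated_image V n (l - 1)" "seq_diff V (l - 1) z = x" by auto
    have zc: "z \<in> carrier (seq_space V (l - 1))" using z(1) iterated_image_subset_carrier[OF V] by blast
    let ?w = "y \<oplus>\<^bsub>seq_space V (l - 1)\<^esub> (\<ominus>\<^bsub>K\<^esub> \<one>\<^bsub>K\<^esub>) \<odot>\<^bsub>seq_space V (l - 1)\<^esub> z"
    have wc: "?w \<in> carrier (seq_space V (l - 1))" using y zc by simp
    have "seq_diff V (l - 1) ?w = \<zero>\<^bsub>seq_space V l\<^esub>"
      using y z(2) zc dD(1)[OF y(1)] by (simp add: dD N.smult_l_minus N.r_neg)
    then have "?w \<in> iterated_image V n (l - 1)" using ker[of ?w "l - 1"] wc by auto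
    then have "?w \<oplus>\<^bsub>seq_space V (l - 1)\<^esub> z \<in> iterated_image V n (l - 1)"
      using M.submoduleE(5)[OF submodule_iterated_image[OF V]] z(1) by blast
    moreover have "?w \<oplus>\<^bsub>seq_space V (l - 1)\<^esub> z = y"
      using y zc by (simp add: M.smult_l_minus M.a_assoc M.l_neg)
    ultimately show ?thesis by simp
  qed
  then show ?thesis using y(2) by blast
qed

text \<open>
  If \<open>x\<close> is not infinitely deep, \<open>\<phi>\<close> is chosen to vanish on the first iterated image that misses \<open>x\<close>, and
  the chain is finite to the left. Otherwise any \<open>\<phi>\<close> that is \<open>1\<close> on \<open>x\<close> can be pulled back forever.
\<close>

lemma dual_chain_leftwards:
  assumes "field K" and V: "seq_object K V" and x: "x \<in> carrier (seq_space V i)" "x \<noteq> \<zero>\<^bsub>seq_space V i\<^esub>"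
    and deep: "(\<exists>n. x \<notin> iterated_image V n i) \<or>
      (\<forall>l. \<forall>v\<in>carrier (seq_space V l). seq_diff V l v = \<zero>\<^bsub>seq_space V (l + 1)\<^esub> \<longrightarrow> v \<in> (\<Inter>n. iterated_image V n l))"
  obtains a xs \<phi>s where "a \<noteq> \<infinity>" "a \<le> Fin i" "dual_chain K V {l. a \<le> Fin l \<and> l \<le> i} xs \<phi>s" "xs i = x"
    "\<And>l v. \<lbrakk>Fin l = a; v \<in> carrier (seq_space V (l - 1))\<rbrakk> \<Longrightarrow> \<phi>s l (seq_diff V (l - 1) v) = \<zero>\<^bsub>K\<^esub>"
proof (cases "\<exists>n. x \<notin> iterated_image V n i")
  case True
  define m where "m = (LEAST n. x \<notin> iterated_image V n i)"
  have m: "x \<notin> iterated_image V m i" using True unfolding m_def by (rule LeastI_ex)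
  then obtain n where n: "m = Suc n" using x(1) by (cases m) auto
  have xn: "x \<in> iterated_image V n i" using not_less_Least[of n "\<lambda>n. x \<notin> iterated_image V n i"] n by (simp add: m_def)
  obtain \<phi> where \<phi>: "\<phi> \<in> linear_maps K (seq_space V i) (scalars K)" "\<phi> x = \<one>\<^bsub>K\<^esub>"
    "\<And>v. v \<in> iterated_image V (Suc n) i \<Longrightarrow> \<phi> v = \<zero>\<^bsub>K\<^esub>"
    using separating_functional[OF \<open>field K\<close> seq_objectD(1)[OF V] submodule_iterated_image[OF V] x(1) m] n by metis
  from dual_chain_leftwards_finite[OF V xn \<phi>] obtain xs \<phi>s where
    *: "dual_chain K V {i - int n..i} xs \<phi>s" "xs i = x"
      "\<forall>v\<in>carrier (seq_space V (i - int n - 1)). \<phi>s (i - int n) (seq_diff V (i - int n - 1) v) = \<zero>\<^bsub>K\<^esub>" by blast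
  have "{l. Fin (i - int n) \<le> Fin l \<and> l \<le> i} = {i - int n..i}" by auto
  then show thesis using * by (intro that[of "Fin (i - int n)" xs \<phi>s]) auto
next
  case False
  then have xM: "x \<in> (\<Inter>n. iterated_image V n i)" by blast
  have ker: "v \<in> (\<Inter>n. iterated_image V n l)"
    if "v \<in> carrier (seq_space V l)" "seq_diff V l v = \<zero>\<^bsub>seq_space V (l + 1)\<^esub>" for l v
    using deep False that by blast
  interpret module K "seq_space V i" by (rule seq_objectD(1)[OF V])
  have "submodule {\<zero>\<^bsub>seq_space V i\<^esub>} K (seq_space V i)" by (rule submodule_criterion) auto
  then obtain \<phi> where \<phi>: "\<phi> \<in> linear_maps K (seq_space V i) (scalars K)" "\<phi> x = \<one>\<^bsub>K\<^esub>"
    using separating_functional[OF \<open>field K\<close> seq_objectD(1)[OF V] _ x(1)] x(2) by blast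
  have "\<exists>y\<in>\<Inter>n. iterated_image V n (l - 1). seq_diff V (l - 1) y = x" if "x \<in> (\<Inter>n. iterated_image V n l)" for l x
    by (rule lift_of_infinitely_deep[OF V ker that])
  from dual_chain_leftwards_infinite[OF V this xM \<phi>]
  obtain xs \<phi>s where "dual_chain K V {..i} xs \<phi>s" "xs i = x" by blast
  moreover have "{l. -\<infinity> \<le> Fin l \<and> l \<le> i} = {..i}" by auto
  ultimately show thesis by (intro that[of "-\<infinity>" xs \<phi>s]) auto
qed

text \<open>
  The starting vector \<open>x\<close> must be extendable to both sides. If some differential has a kernel, \<open>x\<close> is
  a non-zero kernel vector, so that the chain ends at \<open>x\<close>, and is not infinitely deep if there is
  such a kernel vector at all. If all differentials are injective, every non-zero \<open>x\<close> will do.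
\<close>

lemma nonzero_has_interval_dual_chain:
  assumes "field K" and V: "seq_object K V" and nz: "\<not> seq_zero V"
  obtains a b x \<phi> where "interval_ends a b" "dual_chain K V {l. a \<le> Fin l \<and> Fin l \<le> b} x \<phi>"
    "\<And>l. Fin l = b \<Longrightarrow> seq_diff V l (x l) = \<zero>\<^bsub>seq_space V (l + 1)\<^esub>"
    "\<And>l v. \<lbrakk>Fin l = a; v \<in> carrier (seq_space V (l - 1))\<rbrakk> \<Longrightarrow> \<phi> l (seq_diff V (l - 1) v) = \<zero>\<^bsub>K\<^esub>"
proof -
  let ?ker = "\<lambda>l v. v \<in> carrier (seq_space V l) \<and> seq_diff V l v = \<zero>\<^bsub>seq_space V (l + 1)\<^esub>"
  have zero_depth: "\<zero>\<^bsub>seq_space V l\<^esub> \<in> (\<Inter>n. iterated_image V n l)" for l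
    using subgroup.one_closed[OF submodule.axioms(1)[OF submodule_iterated_image[OF V]], of l] by auto
  have zc: "\<zero>\<^bsub>seq_space V l\<^esub> \<in> carrier (seq_space V l)" for l
    by (rule module_zero_closed[OF seq_objectD(1)[OF V]])
  have "\<exists>i x. x \<in> carrier (seq_space V i) \<and> x \<noteq> \<zero>\<^bsub>seq_space V i\<^esub> \<and>
    ((\<exists>n. x \<notin> iterated_image V n i) \<or> (\<forall>l v. ?ker l v \<longrightarrow> v \<in> (\<Inter>n. iterated_image V n l))) \<and>
    (?ker i x \<or> (\<forall>l. inj_on (seq_diff V l) (carrier (seq_space V l))))"
  proof (cases "\<exists>l v. ?ker l v \<and> v \<noteq> \<zero>\<^bsub>seq_space V l\<^esub>")
    case True
    show ?thesis
    proof (cases "\<exists>l v. ?ker l v \<and> v \<notin> (\<Inter>n. iterated_image V n l)")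
      case t: True
      then obtain l v where lv: "?ker l v" "v \<notin> (\<Inter>n. iterated_image V n l)" by blast
      then have "v \<noteq> \<zero>\<^bsub>seq_space V l\<^esub>" using zero_depth by blast
      then show ?thesis using lv by (intro exI[of _ l] exI[of _ v]) simp
    next
      case False
      then have all: "\<forall>l v. ?ker l v \<longrightarrow> v \<in> (\<Inter>n. iterated_image V n l)" by blast
      obtain l v where "?ker l v" "v \<noteq> \<zero>\<^bsub>seq_space V l\<^esub>" using True by blast
      with all show ?thesis by (intro exI[of _ l] exI[of _ v]) simp
    qed
  next
    case False
    have inj: "inj_on (seq_diff V l) (carrier (seq_space V l))" for l
    proof (rule inj_onI)
      interpret M: module K "seq_space V l" by (rule seq_objectD(1)[OF V])
      interpret N: module K "seq_space V (l + 1)" by (rule seq_objectD(1)[OF V])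
      note dD = linear_mapsD[OF seq_objectD(2)[OF V, of l]]
      fix u v assume u: "u \<in> carrier (seq_space V l)" and v: "v \<in> carrier (seq_space V l)"
        and eq: "seq_diff V l u = seq_diff V l v"
      let ?w = "u \<oplus>\<^bsub>seq_space V l\<^esub> (\<ominus>\<^bsub>K\<^esub> \<one>\<^bsub>K\<^esub>) \<odot>\<^bsub>seq_space V l\<^esub> v"
      have "?ker l ?w" using u v eq dD(1)[OF v] by (simp add: dD N.smult_l_minus N.r_neg)
      then have "?w = \<zero>\<^bsub>seq_space V l\<^esub>" using False by blast
      then show "u = v"
        using u v M.minus_equality[of u "\<ominus>\<^bsub>seq_space V l\<^esub> v"] by (simp add: M.smult_l_minus)
    qed
    obtain i x where "x \<in> carrier (seq_space V i)" "x \<noteq> \<zero>\<^bsub>seq_space V i\<^esub>"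
      using nz zc unfolding seq_zero_def by blast
    moreover have "\<forall>l v. ?ker l v \<longrightarrow> v \<in> (\<Inter>n. iterated_image V n l)"
      using False zero_depth by metis
    ultimately show ?thesis using inj by blast
  qed
  then obtain i x where x: "x \<in> carrier (seq_space V i)" "x \<noteq> \<zero>\<^bsub>seq_space V i\<^esub>"
    and left: "(\<exists>n. x \<notin> iterated_image V n i) \<or> (\<forall>l v. ?ker l v \<longrightarrow> v \<in> (\<Inter>n. iterated_image V n l))"
    and right: "seq_diff V i x = \<zero>\<^bsub>seq_space V (i + 1)\<^esub> \<or> (\<forall>l. inj_on (seq_diff V l) (carrier (seq_space V l)))"
    by blast
  from left have left': "(\<exists>n. x \<notin> iterated_image V n i) \<or>
      (\<forall>l. \<forall>v\<in>carrier (seq_space V l). seq_diff V l v = \<zero>\<^bsub>seq_space V (l + 1)\<^esub> \<longrightarrow> v \<in> (\<Inter>n. iterated_image V n l))"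
    by blast
  obtain a xl \<phi>l where a: "a \<noteq> \<infinity>" "a \<le> Fin i" and L: "dual_chain K V {l. a \<le> Fin l \<and> l \<le> i} xl \<phi>l" "xl i = x"
    "\<And>l v. \<lbrakk>Fin l = a; v \<in> carrier (seq_space V (l - 1))\<rbrakk> \<Longrightarrow> \<phi>l l (seq_diff V (l - 1) v) = \<zero>\<^bsub>K\<^esub>"
    by (rule dual_chain_leftwards[OF \<open>field K\<close> V x left']) blast
  have \<phi>: "\<phi>l i \<in> linear_maps K (seq_space V i) (scalars K)" "\<phi>l i x = \<one>\<^bsub>K\<^esub>"
    using L(1,2) a(2) by (auto simp: dual_chain_def)
  obtain b xr \<phi>r where b: "b \<noteq> -\<infinity>" "Fin i \<le> b" and R: "dual_chain K V {l. i \<le> l \<and> Fin l \<le> b} xr \<phi>r"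
    "xr i = x" "\<phi>r i = \<phi>l i" "\<And>l. Fin l = b \<Longrightarrow> seq_diff V l (xr l) = \<zero>\<^bsub>seq_space V (l + 1)\<^esub>"
    by (rule dual_chain_rightwards[OF \<open>field K\<close> V x(1) \<phi> right]) blast
  define X where "X l = (if l \<le> i then xl l else xr l)" for l
  define \<Phi> where "\<Phi> l = (if l \<le> i then \<phi>l l else \<phi>r l)" for l
  have left_le: "Fin l \<le> b" if "l \<le> i" for l using that b(2) by (cases b) auto
  have right_ge: "a \<le> Fin l" if "i \<le> l" for l using that a(2) by (cases a) auto
  have XL: "X l = xl l" "\<Phi> l = \<phi>l l" if "l \<le> i" for l using that by (simp_all add: X_def \<Phi>_def)
  have XR: "X l = xr l" "\<Phi> l = \<phi>r l" if "i \<le> l" for l using that L(2) R(2,3) by (auto simp: X_def \<Phi>_def)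
  have "dual_chain K V {l. a \<le> Fin l \<and> Fin l \<le> b} X \<Phi>"
    unfolding dual_chain_def
  proof (intro conjI ballI allI impI)
    fix l assume l: "l \<in> {l. a \<le> Fin l \<and> Fin l \<le> b}"
    consider "l \<le> i" "l \<in> {l. a \<le> Fin l \<and> l \<le> i}" | "i \<le> l" "l \<in> {l. i \<le> l \<and> Fin l \<le> b}"
      using l by fastforce
    then have "X l \<in> carrier (seq_space V l) \<and> \<Phi> l \<in> linear_maps K (seq_space V l) (scalars K) \<and> \<Phi> l (X l) = \<one>\<^bsub>K\<^esub>"
    proof cases
      case 1 then show ?thesis using L(1) by (simp add: dual_chain_def XL)
    next
      case 2 then show ?thesis using R(1) by (simp add: dual_chain_def XR)
    qed
    then show "X l \<in> carrier (seq_space V l)" "\<Phi> l \<in> linear_maps K (seq_space V l) (scalars K)" "\<Phi> l (X l) = \<one>\<^bsub>K\<^esub>"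
      by blast+
  next
    fix l assume l: "l \<in> {l. a \<le> Fin l \<and> Fin l \<le> b}" "l + 1 \<in> {l. a \<le> Fin l \<and> Fin l \<le> b}"
    consider "l \<le> i" "l + 1 \<le> i" "l \<in> {l. a \<le> Fin l \<and> l \<le> i}" "l + 1 \<in> {l. a \<le> Fin l \<and> l \<le> i}"
      | "i \<le> l" "i \<le> l + 1" "l \<in> {l. i \<le> l \<and> Fin l \<le> b}" "l + 1 \<in> {l. i \<le> l \<and> Fin l \<le> b}"
      using l by fastforce
    then have *: "seq_diff V l (X l) = X (l + 1) \<and> (\<forall>v\<in>carrier (seq_space V l). \<Phi> (l + 1) (seq_diff V l v) = \<Phi> l v)"
    proof cases
      case 1 then show ?thesis using L(1) by (simp add: dual_chain_def XL)
    next
      case 2 then show ?thesis using R(1) by (simp add: dual_chain_def XR)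
    qed
    then show "seq_diff V l (X l) = X (l + 1)" by blast
    fix v assume "v \<in> carrier (seq_space V l)"
    with * show "\<Phi> (l + 1) (seq_diff V l v) = \<Phi> l v" by blast
  qed
  moreover have "interval_ends a b"
    using a b order_trans[OF a(2) b(2)] by (simp add: interval_ends_def)
  moreover have "seq_diff V l (X l) = \<zero>\<^bsub>seq_space V (l + 1)\<^esub>" if "Fin l = b" for l
    using R(4)[OF that] that b(2) XR(1)[of l] by auto
  moreover have "\<Phi> l (seq_diff V (l - 1) v) = \<zero>\<^bsub>K\<^esub>" if "Fin l = a" "v \<in> carrier (seq_space V (l - 1))" for l v
    using L(3)[OF that] that a(2) XL(2)[of l] by auto
  ultimately show thesis using that by blast
qed

section \<open>Interval objects\<close>

lemma interval_succ:
  fixes l :: int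
  assumes "a \<le> Fin l \<and> Fin l \<le> b"
  shows "a \<le> Fin (l + 1) \<and> Fin (l + 1) \<le> b \<longleftrightarrow> Fin l < b" "\<not> Fin l < b \<longleftrightarrow> Fin l = b"
  using assms by (cases a; cases b; auto)+

lemma interval_pred:
  fixes l :: int
  assumes "a \<le> Fin (l + 1) \<and> Fin (l + 1) \<le> b" "\<not> (a \<le> Fin l \<and> Fin l \<le> b)"
  shows "Fin (l + 1) = a"
proof -
  have "Fin l \<le> b" using assms(1) by (cases b) auto
  then have "\<not> a \<le> Fin l" using assms(2) by simp
  then show ?thesis using assms(1) by (cases a) auto
qed

text \<open>
  The sign \<open>(-1)\<close> to the power \<open>l (l - 1) / 2\<close>, which absorbs the alternating signs \<open>(-1)\<close> to the power
  \<open>l\<close> in the differentials of an interval object.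
\<close>

definition staircase_sign :: "('k, 'm) ring_scheme \<Rightarrow> int \<Rightarrow> 'k \<Rightarrow> 'k" where
  "staircase_sign K l c = (if l mod 4 \<le> 1 then c else \<ominus>\<^bsub>K\<^esub> c)"

lemma staircase_sign:
  assumes "cring K" "c \<in> carrier K"
  shows "staircase_sign K l c \<in> carrier K"
    and "staircase_sign K l (staircase_sign K l c) = c"
    and "staircase_sign K (l + 1) c = (if even l then staircase_sign K l c else \<ominus>\<^bsub>K\<^esub> staircase_sign K l c)"
proof -
  interpret cring K by fact
  have "l mod 4 = 0 \<or> l mod 4 = 1 \<or> l mod 4 = 2 \<or> l mod 4 = 3" by presburger
  moreover have "(l + 1) mod 4 = (l mod 4 + 1) mod 4" by presburger
  moreover have "even l \<longleftrightarrow> even (l mod 4)" by presburger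
  ultimately show "staircase_sign K (l + 1) c = (if even l then staircase_sign K l c else \<ominus>\<^bsub>K\<^esub> staircase_sign K l c)"
    using assms(2) by (auto simp: staircase_sign_def)
  show "staircase_sign K l c \<in> carrier K" "staircase_sign K l (staircase_sign K l c) = c"
    using assms(2) by (auto simp: staircase_sign_def)
qed

lemma interval_seq_simps:
  "carrier (seq_space (interval_seq K a b) i) = (if a \<le> Fin i \<and> Fin i \<le> b then carrier K else {\<zero>\<^bsub>K\<^esub>})"
  "\<zero>\<^bsub>seq_space (interval_seq K a b) i\<^esub> = \<zero>\<^bsub>K\<^esub>"
  "x \<oplus>\<^bsub>seq_space (interval_seq K a b) i\<^esub> y = x \<oplus>\<^bsub>K\<^esub> y"
  "c \<odot>\<^bsub>seq_space (interval_seq K a b) i\<^esub> x = c \<otimes>\<^bsub>K\<^esub> x"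
  "seq_diff (interval_seq K a b) i x =
    (if a \<le> Fin i \<and> Fin i < b then (if even i then x else \<ominus>\<^bsub>K\<^esub> x) else \<zero>\<^bsub>K\<^esub>)"
  by (simp_all add: interval_seq_def)

text \<open>
  A dual chain \<open>(x, \<phi>)\<close> gives the idempotent \<open>v \<mapsto> \<phi>(v) x\<close>. It is not zero, so by indecomposability it is
  the identity. Hence \<open>\<phi>\<close>, up to signs, is an isomorphism onto an interval object.
\<close>

lemma indecomposable_imp_interval:
  assumes "field K" and ind: "indecomposable K V"
  shows "\<exists>a b. interval_ends a b \<and> seq_iso K V (interval_seq K a b)"
proof -
  interpret K: field K by fact
  have V: "seq_object K V" and nz: "\<not> seq_zero V" using ind by (auto simp: indecomposable_def)
  obtain a b x \<phi> where ends: "interval_ends a b" and ch: "dual_chain K V {l. a \<le> Fin l \<and> Fin l \<le> b} x \<phi>"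
    and xb: "\<And>l. Fin l = b \<Longrightarrow> seq_diff V l (x l) = \<zero>\<^bsub>seq_space V (l + 1)\<^esub>"
    and \<phi>a: "\<And>l v. \<lbrakk>Fin l = a; v \<in> carrier (seq_space V (l - 1))\<rbrakk> \<Longrightarrow> \<phi> l (seq_diff V (l - 1) v) = \<zero>\<^bsub>K\<^esub>"
    by (rule nonzero_has_interval_dual_chain[OF \<open>field K\<close> V nz]) blast
  let ?I = "\<lambda>l. a \<le> Fin l \<and> Fin l \<le> b"
  let ?s = "staircase_sign K"
  note M = seq_objectD(1)[OF V]
  note dD = linear_mapsD[OF seq_objectD(2)[OF V]]
  note s = staircase_sign[OF K.is_cring]
  have x: "x l \<in> carrier (seq_space V l)" and \<phi>: "\<phi> l \<in> linear_maps K (seq_space V l) (scalars K)"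
    and \<phi>x: "\<phi> l (x l) = \<one>\<^bsub>K\<^esub>" if "?I l" for l
    using ch that by (auto simp: dual_chain_def)
  have dx: "seq_diff V l (x l) = x (l + 1)" and \<phi>d: "\<And>v. v \<in> carrier (seq_space V l) \<Longrightarrow> \<phi> (l + 1) (seq_diff V l v) = \<phi> l v"
    if "?I l" "?I (l + 1)" for l
    using ch that by (auto simp: dual_chain_def)
  note \<phi>D = linear_mapsD[OF \<phi>, simplified]
  have \<phi>_entry: "\<phi> (l + 1) (seq_diff V l v) = \<zero>\<^bsub>K\<^esub>"
    if "\<not> ?I l" "?I (l + 1)" "v \<in> carrier (seq_space V l)" for l v
    using \<phi>a[of "l + 1" v] interval_pred[of a l b] that by auto
  have x_exit: "seq_diff V l (x l) = \<zero>\<^bsub>seq_space V (l + 1)\<^esub>" if "?I l" "\<not> ?I (l + 1)" for l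
    using xb[of l] interval_succ[of a l b] that by blast
  define e where "e l v = (if ?I l then \<phi> l v \<odot>\<^bsub>seq_space V l\<^esub> x l else \<zero>\<^bsub>seq_space V l\<^esub>)" for l v
  have "e \<in> seq_morphisms K V V"
    unfolding seq_morphisms_def
  proof (intro CollectI conjI allI ballI)
    fix l
    interpret M: module K "seq_space V l" by (rule M)
    interpret M': module K "seq_space V (l + 1)" by (rule M)
    show "e l \<in> linear_maps K (seq_space V l) (seq_space V l)"
      by (rule linear_mapsI) (auto simp: e_def x \<phi>D M.smult_l_distr M.smult_assoc1)
    fix v assume v: "v \<in> carrier (seq_space V l)"
    show "e (l + 1) (seq_diff V l v) = seq_diff V l (e l v)"
    proof (cases "?I l")
      case True
      then have "seq_diff V l (e l v) = \<phi> l v \<odot>\<^bsub>seq_space V (l + 1)\<^esub> seq_diff V l (x l)"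
        using v by (simp add: e_def dD \<phi>D x)
      then show ?thesis
        using True v dx \<phi>d x_exit \<phi>D(1)[OF True v] by (auto simp: e_def)
    next
      case False
      then have "e l v = \<zero>\<^bsub>seq_space V l\<^esub>" by (auto simp: e_def)
      then have "seq_diff V l (e l v) = \<zero>\<^bsub>seq_space V (l + 1)\<^esub>"
        using linear_maps_zero[OF M M seq_objectD(2)[OF V]] by simp
      then show ?thesis
        using False v \<phi>_entry x[of "l + 1"] by (auto simp: e_def)
    qed
  qed
  moreover have "\<forall>l. \<forall>v\<in>carrier (seq_space V l). e l (e l v) = e l v"
  proof (intro allI ballI)
    fix l v assume v: "v \<in> carrier (seq_space V l)"
    then show "e l (e l v) = e l v"
      using x \<phi>D(1) by (auto simp: e_def \<phi>D(3) \<phi>x)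
  qed
  moreover obtain l where l: "?I l"
    using seq_nonzero_interval[OF \<open>field K\<close> ends] by (auto simp: seq_zero_def interval_seq_simps split: if_splits)
  have "\<not> (\<forall>i. \<forall>v\<in>carrier (seq_space V i). e i v = \<zero>\<^bsub>seq_space V i\<^esub>)"
  proof
    assume "\<forall>i. \<forall>v\<in>carrier (seq_space V i). e i v = \<zero>\<^bsub>seq_space V i\<^esub>"
    then have "e l (x l) = \<zero>\<^bsub>seq_space V l\<^esub>" using x[OF l] by blast
    then have "x l = \<zero>\<^bsub>seq_space V l\<^esub>"
      using l \<phi>x[OF l] module.smult_one[OF M x[OF l]] by (simp add: e_def)
    then have "\<one>\<^bsub>K\<^esub> = \<zero>\<^bsub>K\<^esub>"
      using linear_maps_zero[OF M module_scalars[OF K.is_cring] \<phi>[OF l]] \<phi>x[OF l] by simp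
    then show False by simp
  qed
  ultimately have e_id: "\<And>l v. v \<in> carrier (seq_space V l) \<Longrightarrow> e l v = v"
    using ind[unfolded indecomposable_iff_idempotents_trivial[OF V]] by blast
  define f where "f l v = (if ?I l then ?s l (\<phi> l v) else \<zero>\<^bsub>K\<^esub>)" for l v
  define g where "g l c = (if ?I l then ?s l c \<odot>\<^bsub>seq_space V l\<^esub> x l else \<zero>\<^bsub>seq_space V l\<^esub>)" for l c
  have sadd: "?s l (c \<oplus>\<^bsub>K\<^esub> d) = ?s l c \<oplus>\<^bsub>K\<^esub> ?s l d" and smul: "?s l (c \<otimes>\<^bsub>K\<^esub> d) = c \<otimes>\<^bsub>K\<^esub> ?s l d"
    if "c \<in> carrier K" "d \<in> carrier K" for l c d
    using that by (simp_all add: staircase_sign_def K.minus_add K.r_minus)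
  have sneg: "?s l (\<ominus>\<^bsub>K\<^esub> c) = \<ominus>\<^bsub>K\<^esub> ?s l c" if "c \<in> carrier K" for l c
    using that by (simp add: staircase_sign_def)
  have f: "f \<in> seq_morphisms K V (interval_seq K a b)"
    unfolding seq_morphisms_def
  proof (intro CollectI conjI allI ballI)
    fix l
    show "f l \<in> linear_maps K (seq_space V l) (seq_space (interval_seq K a b) l)"
      by (rule linear_mapsI) (auto simp: f_def interval_seq_simps \<phi>D s sadd smul)
    fix v assume v: "v \<in> carrier (seq_space V l)"
    show "f (l + 1) (seq_diff V l v) = seq_diff (interval_seq K a b) l (f l v)"
    proof (cases "?I l")
      case True
      show ?thesis
      proof (cases "?I (l + 1)")
        case t: True
        then have "Fin l < b" using interval_succ[OF True] by blast
        then show ?thesis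
          using True t v by (simp add: f_def interval_seq_simps \<phi>d s(3)[OF \<phi>D(1)])
      next
        case False
        then have "\<not> Fin l < b" using interval_succ[OF True] by blast
        with False show ?thesis by (auto simp: f_def interval_seq_simps)
      qed
    next
      case False
      then have "seq_diff (interval_seq K a b) l (f l v) = \<zero>\<^bsub>K\<^esub>"
        by (auto simp: f_def interval_seq_simps)
      moreover have "?s l \<zero>\<^bsub>K\<^esub> = \<zero>\<^bsub>K\<^esub>" for l by (simp add: staircase_sign_def)
      ultimately show ?thesis using False v \<phi>_entry by (auto simp: f_def)
    qed
  qed
  have g: "g \<in> seq_morphisms K (interval_seq K a b) V"
    unfolding seq_morphisms_def
  proof (intro CollectI conjI allI ballI)
    fix l
    interpret M: module K "seq_space V l" by (rule M)
    interpret M': module K "seq_space V (l + 1)" by (rule M)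
    show "g l \<in> linear_maps K (seq_space (interval_seq K a b) l) (seq_space V l)"
      by (rule linear_mapsI)
         (auto simp: g_def interval_seq_simps x s sadd smul M.smult_l_distr M.smult_assoc1)
    fix c assume c: "c \<in> carrier (seq_space (interval_seq K a b) l)"
    then have cK: "c \<in> carrier K" by (auto simp: interval_seq_simps split: if_splits)
    show "g (l + 1) (seq_diff (interval_seq K a b) l c) = seq_diff V l (g l c)"
    proof (cases "?I l")
      case True
      then have "seq_diff V l (g l c) = ?s l c \<odot>\<^bsub>seq_space V (l + 1)\<^esub> seq_diff V l (x l)"
        using cK by (simp add: g_def dD x s)
      moreover have "g (l + 1) (seq_diff (interval_seq K a b) l c) = ?s l c \<odot>\<^bsub>seq_space V (l + 1)\<^esub> x (l + 1)"
        if "?I (l + 1)"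
        using that True interval_succ[OF True] cK
        by (auto simp: g_def interval_seq_simps s sneg)
      ultimately show ?thesis using True dx x_exit s(1)[OF cK] by (cases "?I (l + 1)") (auto simp: g_def)
    next
      case False
      have z: "?s l \<zero>\<^bsub>K\<^esub> = \<zero>\<^bsub>K\<^esub>" for l by (simp add: staircase_sign_def)
      have "g l c = \<zero>\<^bsub>seq_space V l\<^esub>" using False by (auto simp: g_def)
      then have "seq_diff V l (g l c) = \<zero>\<^bsub>seq_space V (l + 1)\<^esub>"
        using linear_maps_zero[OF M M seq_objectD(2)[OF V]] by simp
      moreover have "seq_diff (interval_seq K a b) l c = \<zero>\<^bsub>K\<^esub>"
        using False by (auto simp: interval_seq_simps)
      ultimately show ?thesis using x[of "l + 1"] by (auto simp: g_def z)
    qed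
  qed
  have gf: "g l (f l v) = v" if v: "v \<in> carrier (seq_space V l)" for l v
    using e_id[OF v] v by (auto simp: f_def g_def e_def s \<phi>D)
  have fg: "f l (g l c) = c" if c: "c \<in> carrier (seq_space (interval_seq K a b) l)" for l c
    using c x s(1) \<phi>D(3) \<phi>x by (auto simp: f_def g_def interval_seq_simps s split: if_splits)
  have "seq_iso K V (interval_seq K a b)"
    unfolding seq_iso_def using f g gf fg by blast
  with ends show ?thesis by blast
qed

text \<open>
  An endomorphism of an interval object is multiplication by a scalar in each degree. Consecutive
  degrees are linked by an isomorphism, so it is the same scalar throughout; if the endomorphism is
  idempotent, the scalar is \<open>0\<close> or \<open>1\<close>.
\<close>

lemma indecomposable_interval:
  assumes "field K" "interval_ends a b"
  shows "indecomposable K (interval_seq K a b)"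
proof -
  interpret K: field K by fact
  let ?S = "interval_seq K a b"
  let ?I = "\<lambda>l. a \<le> Fin l \<and> Fin l \<le> b"
  have S: "seq_object K ?S" by (rule seq_object_interval[OF K.is_cring])
  show ?thesis
    unfolding indecomposable_iff_idempotents_trivial[OF S]
  proof (intro conjI ballI impI)
    show "\<not> seq_zero ?S" by (rule seq_nonzero_interval[OF assms])
    fix e assume e: "e \<in> seq_morphisms K ?S ?S"
      and idem: "\<forall>i. \<forall>x\<in>carrier (seq_space ?S i). e i (e i x) = e i x"
    note eD = linear_mapsD[OF seq_morphismsD(1)[OF e], unfolded interval_seq_simps]
    define c where "c l = e l \<one>\<^bsub>K\<^esub>" for l
    have c: "c l \<in> carrier K" if "?I l" for l using eD(1)[of "\<one>\<^bsub>K\<^esub>" l] that by (simp add: c_def)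
    have ec: "e l x = x \<otimes>\<^bsub>K\<^esub> c l" if "?I l" "x \<in> carrier K" for l x
      using eD(3)[of x "\<one>\<^bsub>K\<^esub>" l] that by (simp add: c_def)
    have step: "c (l + 1) = c l" if l: "?I l" "?I (l + 1)" for l
    proof -
      have lb: "Fin l < b" using interval_succ[OF l(1)] l(2) by blast
      have "e (l + 1) (seq_diff ?S l \<one>\<^bsub>K\<^esub>) = seq_diff ?S l (e l \<one>\<^bsub>K\<^esub>)"
        by (rule seq_morphismsD(3)[OF e]) (simp add: interval_seq_simps l)
      then have "(if even l then c (l + 1) else \<ominus>\<^bsub>K\<^esub> c (l + 1)) = (if even l then c l else \<ominus>\<^bsub>K\<^esub> c l)"
        using l lb c by (cases "even l") (auto simp: interval_seq_simps ec K.l_minus)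
      then show ?thesis using c l K.minus_minus by (metis)
    qed
    have const: "c (l + int n) = c l" if "?I l" "?I (l + int n)" for l n
      using that(2)
    proof (induction n)
      case (Suc n)
      have "?I (l + int n)" using that(1) Suc.prems by (cases a; cases b; auto)
      with Suc step[of "l + int n"] show ?case by (simp add: ac_simps)
    qed simp
    obtain i where i: "?I i"
      using seq_nonzero_interval[OF assms] by (auto simp: seq_zero_def interval_seq_simps split: if_splits)
    have ci: "c l = c i" if l: "?I l" for l
    proof (cases "i \<le> l")
      case True then show ?thesis using const[of i "nat (l - i)"] i l by simp
    next
      case False then show ?thesis using const[of l "nat (i - l)"] i l by simp
    qed
    have z: "e l \<zero>\<^bsub>K\<^esub> = \<zero>\<^bsub>K\<^esub>" for l
      using linear_maps_zero[OF seq_objectD(1)[OF S] seq_objectD(1)[OF S] seq_morphismsD(1)[OF e]]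
      by (simp add: interval_seq_simps)
    have "e i (e i \<one>\<^bsub>K\<^esub>) = e i \<one>\<^bsub>K\<^esub>" using idem i by (simp add: interval_seq_simps)
    then have cc: "c i \<otimes>\<^bsub>K\<^esub> c i = c i" using ec[OF i c[OF i]] by (simp add: c_def)
    have "c i = \<zero>\<^bsub>K\<^esub> \<or> c i = \<one>\<^bsub>K\<^esub>"
      using cc c[OF i] K.m_rcancel[of "c i" "c i" "\<one>\<^bsub>K\<^esub>"] by auto
    then show "(\<forall>i. \<forall>x\<in>carrier (seq_space ?S i). e i x = \<zero>\<^bsub>seq_space ?S i\<^esub>) \<or>
      (\<forall>i. \<forall>x\<in>carrier (seq_space ?S i). e i x = x)"
    proof
      assume "c i = \<zero>\<^bsub>K\<^esub>"
      then have "e l x = \<zero>\<^bsub>K\<^esub>" if "x \<in> carrier (seq_space ?S l)" for l x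
        using that ec ci z by (auto simp: interval_seq_simps split: if_splits)
      then show ?thesis by (simp add: interval_seq_simps(2))
    next
      assume "c i = \<one>\<^bsub>K\<^esub>"
      then have "e l x = x" if "x \<in> carrier (seq_space ?S l)" for l x
        using that ec ci z by (auto simp: interval_seq_simps split: if_splits)
      then show ?thesis by blast
    qed
  qed
qed

section \<open>Classification\<close>

lemma indecomposable_iff_interval:
  assumes "field K" "seq_object K V"
  shows "indecomposable K V \<longleftrightarrow> (\<exists>a b. interval_ends a b \<and> seq_iso K V (interval_seq K a b))"
proof
  have "cring K" using \<open>field K\<close> by (simp add: field_def domain_def)
  assume "\<exists>a b. interval_ends a b \<and> seq_iso K V (interval_seq K a b)"
  then show "indecomposable K V"
    using indecomposable_iso[OF \<open>cring K\<close> indecomposable_interval[OF \<open>field K\<close>] \<open>seq_object K V\<close>] seq_iso_sym by blast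
qed (rule indecomposable_imp_interval[OF \<open>field K\<close>])

theorem corollary1p16:
  fixes K :: "('k, 'm) ring_scheme" and V :: "('k, 'v) seq"
  assumes "field K" and "seq_object K V"
  shows "(indecomposable K V \<longleftrightarrow> (\<exists>a b. interval_ends a b \<and> seq_iso K V (interval_seq K a b))) \<and>
         (completely_decomposable K V \<longleftrightarrow> V \<in> seq_Sd K)"
proof (intro conjI iffI)
  have "cring K" using \<open>field K\<close> by (simp add: field_def domain_def)
  show "indecomposable K V \<Longrightarrow> \<exists>a b. interval_ends a b \<and> seq_iso K V (interval_seq K a b)"
    "\<exists>a b. interval_ends a b \<and> seq_iso K V (interval_seq K a b) \<Longrightarrow> indecomposable K V"
    using indecomposable_iff_interval[OF assms] by blast+
  show "V \<in> seq_Sd K" if "completely_decomposable K V"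
  proof -
    obtain J :: "(int \<times> 'v) set" and W :: "int \<times> 'v \<Rightarrow> ('k, 'v) seq"
      where W: "\<And>j. j \<in> J \<Longrightarrow> indecomposable K (W j)" and iso: "seq_iso K V (seq_coproduct J W)"
      using \<open>completely_decomposable K V\<close> unfolding completely_decomposable_def by blast
    have "\<forall>j\<in>J. \<exists>a b. interval_ends a b \<and> seq_iso K (W j) (interval_seq K a b)"
      using indecomposable_imp_interval[OF \<open>field K\<close> W] by blast
    then obtain a b where ab: "\<And>j. j \<in> J \<Longrightarrow> interval_ends (a j) (b j)"
      "\<And>j. j \<in> J \<Longrightarrow> seq_iso K (W j) (interval_seq K (a j) (b j))" by metis
    have W_iso: "seq_iso K (seq_coproduct J W) (seq_coproduct J (\<lambda>j. interval_seq K (a j) (b j)))"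
      using W ab(2) seq_object_interval[OF \<open>cring K\<close>]
      by (intro seq_iso_direct_sum[of id]) (auto simp: indecomposable_def)
    show ?thesis
      by (rule seq_Sd_any_type[OF assms ab(1) seq_iso_trans[OF iso W_iso]])
  qed
  show "completely_decomposable K V" if Sd: "V \<in> seq_Sd K"
  proof -
    obtain J :: "(int \<times> 'v) set" and a b where ab: "\<And>j. j \<in> J \<Longrightarrow> interval_ends (a j) (b j)"
      and iso: "seq_iso K V (seq_coproduct J (\<lambda>j. interval_seq K (a j) (b j)))"
      using Sd unfolding seq_Sd_def by blast
    show ?thesis
      by (rule completely_decomposable_any_type[OF \<open>cring K\<close> \<open>seq_object K V\<close> _ iso])
         (rule indecomposable_interval[OF \<open>field K\<close> ab])
  qed
qed

end
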